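(* Let $\mathcal{E}_{n,\tau}$ be the fully discrete solution matrix of the lumped mass (LM) method. Then $\mathcal{E}_{n,\tau}\ge0$ (elementwise) for all $\tau>0$, $n\ge1$, if $\mathcal{T}_h$ is Delaunay, and, conversely, if $\mathcal{E}_{1,\tau}\ge0$ for all $\tau>0$, then $\mathcal{T}_h$ is Delaunay.
   Context: Characteristic function. One of two cases is assumed. Case I: $P(z)=\sum_{i=1}^m b_iz^{\alpha_i}$, $m\ge1$, $0<\alpha_m<\dots<\alpha_1<1$, $b_i>0$, $b_1=1$. Case II: $P(z)=\int_0^1z^\alpha\mu(\alpha)\,d\alpha$, with $\mu\ge0$ Hölder continuous on $[0,1]$ and $\mu(0)\mu(1)>0$. Finite elements. $\Omega\subset\mathbb{R}^2$ is a bounded polygonal domain, $\mathcal{T}_h$ a triangulation of $\Omega$ (from a shape regular quasi-uniform family), $X_h\subset H_0^1(\Omega)$ the space of continuous functions that are linear on each triangle of $\mathcal{T}_h$ and vanish on $\partial\Omega$. $P_1,\dots,P_N$ are the interior nodes and $\phi_1,\dots,\phi_N$ the corresponding nodal basis. The stiffness matrix is $\mathcal{S}=(s_{ij})$, $s_{ij}=\int_\Omega\nabla\phi_j\cdot\nabla\phi_i\,dx$. In the LM method the mass matrix is $\mathcal{M}=(m_{ij})$, $m_{ij}=[\phi_j,\phi_i]$, with $[w,\chi]=\sum_{K\in\mathcal{T}_h}\frac13|K|\sum_{l=1}^3(w\chi)(P_l^K)$, where $P_1^K,P_2^K,P_3^K$ are the vertices of $K$ and $|K|$ its area; thus $\mathcal{M}$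 is diagonal with positive diagonal. Set $\mathcal{H}=\mathcal{M}^{-1}\mathcal{S}$, and let $\mathcal{I}$ be the identity matrix. Delaunay. An edge $e$ of $\mathcal{T}_h$ is called a Delaunay edge if the sum of the angles $\psi_1$ and $\psi_2$ opposite $e$ is $\le\pi$. $\mathcal{T}_h$ is a Delaunay triangulation if all interior edges are Delaunay. Fully discrete scheme. For a time step $\tau>0$ the weights $\omega_j=\omega_j(\tau)$ are defined by $\sum_{j=0}^\infty\omega_j\xi^j=P((1-\xi)/\tau)$, so $\omega_0=P(\tau^{-1})$. The solution matrices $\mathcal{E}_{n,\tau}$ are defined by $U^n=\mathcal{E}_{n,\tau}V$, where $U^0=V$ and, for $n\ge1$, $$U^n=(\omega_0\mathcal{I}+\mathcal{H})^{-1}\Big(\sum_{j=0}^{n-1}\omega_jV-\sum_{j=1}^{n-1}\omega_{n-j}U^j\Big).$$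
   Formalization: "Interior edges" in the Delaunay definition are taken to be edges joining two interior nodes; if all edges not on the boundary are meant, the converse is false (e.g. a mesh with one interior node, where the solution matrices are positive scalars). *)

theory Defs
  imports "HOL-Analysis.Analysis"
begin

section \<open>Characteristic functions\<close>

(* Only the values P(z) for real z > 0 are constrained: these are the ones entering P((1-xi)/tau). *)

definition multi_term :: "(real \<Rightarrow> real) \<Rightarrow> bool" where
  "multi_term P \<longleftrightarrow> (\<exists>(m::nat) \<alpha> b.
     m \<ge> 1 \<and> 0 < \<alpha> m \<and> (\<forall>i\<in>{1..<m}. \<alpha> (i + 1) < \<alpha> i) \<and> \<alpha> 1 < 1 \<and>
     (\<forall>i\<in>{1..m}. 0 < b i) \<and> b 1 = 1 \<and>
     (\<forall>z>0. P z = (\<Sum>i=1..m. b i * z powr \<alpha> i)))"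

definition hoelder_continuous_on :: "real set \<Rightarrow> (real \<Rightarrow> real) \<Rightarrow> bool" where
  "hoelder_continuous_on S f \<longleftrightarrow>
     (\<exists>\<gamma> C. 0 < \<gamma> \<and> \<gamma> \<le> 1 \<and> (\<forall>x\<in>S. \<forall>y\<in>S. \<bar>f x - f y\<bar> \<le> C * \<bar>x - y\<bar> powr \<gamma>))"

definition distributed_order :: "(real \<Rightarrow> real) \<Rightarrow> bool" where
  "distributed_order P \<longleftrightarrow> (\<exists>\<mu>.
     (\<forall>\<alpha>\<in>{0..1}. 0 \<le> \<mu> \<alpha>) \<and> hoelder_continuous_on {0..1} \<mu> \<and> 0 < \<mu> 0 * \<mu> 1 \<and>
     (\<forall>z>0. P z = integral {0..1} (\<lambda>\<alpha>. z powr \<alpha> * \<mu> \<alpha>)))"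

definition characteristic_function :: "(real \<Rightarrow> real) \<Rightarrow> bool" where
  "characteristic_function P \<longleftrightarrow> multi_term P \<or> distributed_order P"


section \<open>Triangulations of polygonal domains\<close>

definition polygonal_domain :: "(real^2) set \<Rightarrow> bool" where
  "polygonal_domain \<Omega> \<longleftrightarrow> open \<Omega> \<and> connected \<Omega> \<and> bounded \<Omega> \<and> \<Omega> \<noteq> {} \<and>
     (\<exists>\<S>. finite \<S> \<and> (\<forall>s\<in>\<S>. \<exists>a b. s = closed_segment a b) \<and> frontier \<Omega> = \<Union>\<S>)"

(* The last clause (the boundary is made up of edges of the mesh) is automatic if Omega is the
   interior of its closure; in general it rules out slits that are not resolved by the mesh. *)
definition triangulation_of :: "(real^2) set \<Rightarrow> (real^2) set set \<Rightarrow> bool" where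
  "triangulation_of \<Omega> \<T> \<longleftrightarrow> triangulation \<T> \<and> (\<forall>K\<in>\<T>. 2 simplex K) \<and> \<Union>\<T> = closure \<Omega> \<and>
     frontier \<Omega> = \<Union>{e. e \<subseteq> frontier \<Omega> \<and> (\<exists>K\<in>\<T>. e edge_of K)}"

definition shape_regular_quasi_uniform :: "(real^2) set \<Rightarrow> (real^2) set set set \<Rightarrow> bool" where
  "shape_regular_quasi_uniform \<Omega> \<F> \<longleftrightarrow> (\<forall>\<T>\<in>\<F>. triangulation_of \<Omega> \<T>) \<and>
     (\<exists>\<sigma>>0. \<forall>\<T>\<in>\<F>. \<forall>K\<in>\<T>. \<exists>x. cball x (\<sigma> * diameter K) \<subseteq> K) \<and>
     (\<exists>\<rho>>0. \<forall>\<T>\<in>\<F>. \<forall>K\<in>\<T>. \<forall>L\<in>\<T>. \<rho> * diameter L \<le> diameter K)"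

definition vertices :: "(real^2) set \<Rightarrow> (real^2) set" where
  "vertices K = {x. x extreme_point_of K}"

definition interior_nodes :: "(real^2) set \<Rightarrow> (real^2) set set \<Rightarrow> (real^2) set" where
  "interior_nodes \<Omega> \<T> = (\<Union>K\<in>\<T>. vertices K) \<inter> \<Omega>"

(* The angle at c in the triangle a b c. *)
definition angle_at :: "real^2 \<Rightarrow> real^2 \<Rightarrow> real^2 \<Rightarrow> real" where
  "angle_at c a b = arccos (((a - c) \<bullet> (b - c)) / (norm (a - c) * norm (b - c)))"

definition delaunay_edge :: "(real^2) set set \<Rightarrow> (real^2) set \<Rightarrow> bool" where
  "delaunay_edge \<T> e \<longleftrightarrow> (\<forall>a b c d.
     e = closed_segment a b \<and> c \<noteq> d \<and> convex hull {a, b, c} \<in> \<T> \<and> convex hull {a, b, d} \<in> \<T> \<longrightarrow>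
     angle_at c a b + angle_at d a b \<le> pi)"

(* Interior edges are the edges joining two interior nodes, i.e. those carrying an off-diagonal
   entry of the stiffness matrix. An edge with an endpoint on the boundary has no counterpart in
   that matrix, so that nonnegativity of the solution matrices cannot imply the Delaunay property
   for it: take nodes (1,0), (1/2,1/10), (-1,0), (1/2,-1/10) on the boundary of a quadrilateral
   and the single interior node (0,0); there the matrices are positive scalars, but the edge from
   (0,0) to (1,0) has opposite angles of sum greater than pi. *)
definition interior_edge :: "(real^2) set \<Rightarrow> (real^2) set set \<Rightarrow> (real^2) set \<Rightarrow> bool" where
  "interior_edge \<Omega> \<T> e \<longleftrightarrow> (\<exists>K\<in>\<T>. e edge_of K) \<and> vertices e \<subseteq> interior_nodes \<Omega> \<T>"

definition delaunay :: "(real^2) set \<Rightarrow> (real^2) set set \<Rightarrow> bool" where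
  "delaunay \<Omega> \<T> \<longleftrightarrow> (\<forall>e. interior_edge \<Omega> \<T> e \<longrightarrow> delaunay_edge \<T> e)"


section \<open>Finite element space and lumped mass matrices\<close>

(* Values outside the closure of Omega are irrelevant for everything below. *)
definition fe_space :: "(real^2) set \<Rightarrow> (real^2) set set \<Rightarrow> (real^2 \<Rightarrow> real) set" where
  "fe_space \<Omega> \<T> = {f. continuous_on (closure \<Omega>) f \<and>
     (\<forall>K\<in>\<T>. \<exists>g c. \<forall>x\<in>K. f x = g \<bullet> x + c) \<and> (\<forall>x\<in>frontier \<Omega>. f x = 0)}"

definition nodal_basis ::
  "(real^2) set \<Rightarrow> (real^2) set set \<Rightarrow> ('n \<Rightarrow> real^2) \<Rightarrow> ('n \<Rightarrow> real^2 \<Rightarrow> real) \<Rightarrow> bool" where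
  "nodal_basis \<Omega> \<T> p \<phi> \<longleftrightarrow>
     (\<forall>i. \<phi> i \<in> fe_space \<Omega> \<T> \<and> (\<forall>j. \<phi> i (p j) = (if i = j then 1 else 0)))"

(* Pointwise gradient; for finite element functions it exists off the edges of the mesh, a null
   set, and represents the weak gradient. *)
definition grad :: "(real^2 \<Rightarrow> real) \<Rightarrow> real^2 \<Rightarrow> real^2" where
  "grad f x = (\<chi> k. frechet_derivative f (at x) (axis k 1))"

definition stiffness_matrix :: "(real^2) set \<Rightarrow> ('n \<Rightarrow> real^2 \<Rightarrow> real) \<Rightarrow> real^'n^'n" where
  "stiffness_matrix \<Omega> \<phi> = (\<chi> i j. integral \<Omega> (\<lambda>x. grad (\<phi> j) x \<bullet> grad (\<phi> i) x))"

definition lumped_inner ::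
  "(real^2) set set \<Rightarrow> (real^2 \<Rightarrow> real) \<Rightarrow> (real^2 \<Rightarrow> real) \<Rightarrow> real" where
  "lumped_inner \<T> w v = (\<Sum>K\<in>\<T>. 1/3 * measure lebesgue K * (\<Sum>q\<in>vertices K. w q * v q))"

definition lumped_mass_matrix :: "(real^2) set set \<Rightarrow> ('n \<Rightarrow> real^2 \<Rightarrow> real) \<Rightarrow> real^'n^'n" where
  "lumped_mass_matrix \<T> \<phi> = (\<chi> i j. lumped_inner \<T> (\<phi> j) (\<phi> i))"

definition lm_matrix ::
  "(real^2) set \<Rightarrow> (real^2) set set \<Rightarrow> ('n::finite \<Rightarrow> real^2 \<Rightarrow> real) \<Rightarrow> real^'n^'n" where
  "lm_matrix \<Omega> \<T> \<phi> = matrix_inv (lumped_mass_matrix \<T> \<phi>) ** stiffness_matrix \<Omega> \<phi>"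


section \<open>Fully discrete scheme\<close>

(* A power series identity on (-1,1) determines the coefficients. *)
definition scheme_weights :: "(real \<Rightarrow> real) \<Rightarrow> real \<Rightarrow> (nat \<Rightarrow> real) \<Rightarrow> bool" where
  "scheme_weights P \<tau> \<omega> \<longleftrightarrow>
     (\<forall>\<xi>. \<bar>\<xi>\<bar> < 1 \<longrightarrow> (\<lambda>j. \<omega> j * \<xi> ^ j) sums P ((1 - \<xi>) / \<tau>))"

declare sum.cong [fundef_cong]

fun discrete_solution :: "(nat \<Rightarrow> real) \<Rightarrow> real^'n^'n \<Rightarrow> real^'n::finite \<Rightarrow> nat \<Rightarrow> real^'n" where
  "discrete_solution \<omega> H V n =
     (if n = 0 then V
      else matrix_inv (\<omega> 0 *\<^sub>R mat 1 + H) *v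
        ((\<Sum>j\<in>{0..<n}. \<omega> j *\<^sub>R V) - (\<Sum>j\<in>{1..<n}. \<omega> (n - j) *\<^sub>R discrete_solution \<omega> H V j)))"

declare discrete_solution.simps [simp del]

(* The matrix of the linear map taking V to U^n. *)
definition solution_matrix :: "(nat \<Rightarrow> real) \<Rightarrow> real^'n^'n \<Rightarrow> nat \<Rightarrow> real^'n^'n::finite" where
  "solution_matrix \<omega> H n = matrix (\<lambda>V. discrete_solution \<omega> H V n)"

end

theory Submission
  imports Defs
begin

text \<open>Write \<open>M\<close> and \<open>S\<close> for the lumped mass and stiffness matrices, so that \<open>H = M\<^sup>-\<^sup>1 S\<close>.
  On a triangle the gradients of two nodal basis functions pair to minus half the cotangent of the angle
  opposite to their common edge, hence the entry of \<open>S\<close> belonging to an edge is nonpositive iff the two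
  opposite angles have sum at most \<open>\<pi>\<close>. Thus \<open>\<T>\<close> is Delaunay iff all off-diagonal entries of \<open>S\<close>
  are nonpositive.

  In that case \<open>w M + S\<close>, with \<open>w = \<omega>\<^sub>0 > 0\<close>, is a Stieltjes matrix, so \<open>(w I + H)\<^sup>-\<^sup>1 \<ge> 0\<close>. The generating
  function of the weights is a superposition of the powers \<open>(1 - \<xi>)\<^sup>\<alpha>\<close> with \<open>0 \<le> \<alpha> \<le> 1\<close>, whence
  \<open>\<omega>\<^sub>j \<le> 0\<close> for \<open>j \<ge> 1\<close>, while all partial sums are nonnegative; nonnegativity of the scheme follows by
  induction on \<open>n\<close>. Conversely, \<open>w (w I + H)\<^sup>-\<^sup>1 = I - w\<^sup>-\<^sup>1 H + O(w\<^sup>-\<^sup>2)\<close> and \<open>w \<rightarrow> \<infinity>\<close> as \<open>\<tau> \<rightarrow> 0\<close>, so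
  nonnegativity of the first step forces the off-diagonal entries of \<open>H\<close> to be nonpositive.\<close>

section \<open>Signs of the weights\<close>

text \<open>Negating the upper index absorbs the sign: the expression equals
  \<open>real k - \<alpha> gchoose k\<close>, whose numerator is a product of factors
  \<open>real k - \<alpha> - real i\<close> with \<open>i < k\<close>, each at least
  \<open>1 - \<alpha>\<close>.\<close>

lemma alternating_gbinomial_nonneg:
  fixes \<alpha> :: real
  assumes "\<alpha> \<le> 1"
  shows "0 \<le> (- 1) ^ k * (\<alpha> - 1 gchoose k)"
proof -
  have "(- 1) ^ k * (\<alpha> - 1 gchoose k) = (real k - \<alpha> gchoose k)"
    by (subst gbinomial_negated_upper) (simp flip: power_add add: mult.assoc[symmetric] power_mult_distrib[symmetric])
  also have "\<dots> = (\<Prod>i = 0..<k. real k - \<alpha> - real i) / fact k"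
    by (simp add: gbinomial_prod_rev)
  also have "\<dots> \<ge> 0"
    using assms by (intro divide_nonneg_nonneg prod_nonneg) auto
  finally show ?thesis .
qed

text \<open>The coefficient of \<xi>^j in the binomial series of (1 - \<xi>)^\<alpha>, that is, the
  weight of backward Euler convolution quadrature of order \<alpha> for unit time step.\<close>

definition frac_coeff :: "nat \<Rightarrow> real \<Rightarrow> real" where
  "frac_coeff j \<alpha> = (- 1) ^ j * (\<alpha> gchoose j)"

lemma frac_coeff_0 [simp]: "frac_coeff 0 \<alpha> = 1"
  by (simp add: frac_coeff_def)

text \<open>The absorption identity extracts the factor \<open>\<alpha> / real (Suc k)\<close> and
  lowers the upper index to \<open>\<alpha> - 1\<close>; exactly one sign is left over.\<close>

lemma frac_coeff_nonpos:
  assumes "\<alpha> \<in> {0..1}" "0 < j"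
  shows "frac_coeff j \<alpha> \<le> 0"
proof -
  obtain k where k: "j = Suc k" using assms(2) gr0_implies_Suc by blast
  have "frac_coeff j \<alpha> = - (\<alpha> / real (Suc k)) * ((- 1) ^ k * (\<alpha> - 1 gchoose k))"
    using gbinomial_absorption'[of "Suc k" \<alpha>] by (simp add: frac_coeff_def k)
  also have "\<dots> \<le> 0"
    using alternating_gbinomial_nonneg[of \<alpha> k] assms(1)
    by (intro mult_nonpos_nonneg) auto
  finally show ?thesis .
qed

text \<open>Partial alternating sums of binomial coefficients telescope to the single term
  \<open>(- 1) ^ n * (\<alpha> - 1 gchoose n)\<close>.\<close>

lemma frac_coeff_sum_nonneg:
  assumes "\<alpha> \<in> {0..1}"
  shows "0 \<le> (\<Sum>j\<le>n. frac_coeff j \<alpha>)"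
  using gbinomial_sum_lower_neg[of \<alpha> n] alternating_gbinomial_nonneg[of \<alpha> n] assms
  by (simp add: frac_coeff_def mult.commute)

text \<open>The zeroth coefficient is 1 and all later ones are nonpositive, so nonnegative partial
  sums leave a total negative mass of at most 1. The bound is uniform in \<alpha> and serves as a
  majorant when the series is integrated over \<alpha>.\<close>

lemma frac_coeff_abs_le_1:
  assumes "\<alpha> \<in> {0..1}"
  shows "\<bar>frac_coeff j \<alpha>\<bar> \<le> 1"
proof (cases j)
  case (Suc k)
  have "(\<Sum>j\<le>k. frac_coeff j \<alpha>) = 1 + (\<Sum>j=1..k. frac_coeff j \<alpha>)"
    by (simp add: atMost_atLeast0 sum.atLeast_Suc_atMost)
  moreover have "(\<Sum>j=1..k. frac_coeff j \<alpha>) \<le> 0"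
    using frac_coeff_nonpos[OF assms] by (intro sum_nonpos) auto
  ultimately show ?thesis
    using frac_coeff_sum_nonneg[OF assms, of j] frac_coeff_nonpos[OF assms, of j] Suc by simp
qed simp

lemma continuous_on_frac_coeff: "continuous_on A (frac_coeff j)"
  unfolding frac_coeff_def gbinomial_prod_rev by (intro continuous_intros) auto

lemma frac_coeff_sums:
  assumes "\<bar>\<xi>\<bar> < 1" "0 < \<tau>"
  shows "(\<lambda>j. frac_coeff j \<alpha> * \<xi> ^ j * \<tau> powr - \<alpha>) sums (((1 - \<xi>) / \<tau>) powr \<alpha>)"
proof -
  have "(\<lambda>j. (\<alpha> gchoose j) * (- \<xi>) ^ j) sums (1 + - \<xi>) powr \<alpha>"
    using assms by (intro gen_binomial_real) auto
  then have "(\<lambda>j. (\<alpha> gchoose j) * (- \<xi>) ^ j * \<tau> powr - \<alpha>) sums ((1 + - \<xi>) powr \<alpha> * \<tau> powr - \<alpha>)"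
    by (rule sums_mult2)
  moreover have "(1 + - \<xi>) powr \<alpha> * \<tau> powr - \<alpha> = ((1 - \<xi>) / \<tau>) powr \<alpha>"
    using assms by (simp add: powr_divide powr_minus_divide)
  moreover have "(\<alpha> gchoose j) * (- \<xi>) ^ j = frac_coeff j \<alpha> * \<xi> ^ j" for j
    by (simp add: frac_coeff_def power_minus[of \<xi>])
  ultimately show ?thesis by simp
qed

text \<open>Strong induction: once the coefficients below \<open>k\<close> vanish, division by
  \<xi>^k leaves a power series with sum 0 at every nonzero \<xi>, and its limit at the origin is
  \<open>d k\<close>.\<close>

lemma powser_eq_0:
  fixes d :: "nat \<Rightarrow> real"
  assumes "\<And>\<xi>. \<bar>\<xi>\<bar> < 1 \<Longrightarrow> (\<lambda>j. d j * \<xi> ^ j) sums 0"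
  shows "d k = 0"
proof (induction k rule: less_induct)
  case (less k)
  have "((\<lambda>_. 0) \<longlongrightarrow> d (0 + k)) (at (0::real))"
  proof (rule powser_limit_0_strong[where s = 1 and a = "\<lambda>j. d (j + k)"])
    fix \<xi> :: real assume \<xi>: "\<xi> \<noteq> 0" "norm \<xi> < 1"
    have "(\<Sum>j<k. d j * \<xi> ^ j) = 0" using less by simp
    then have "(\<lambda>j. d (j + k) * \<xi> ^ (j + k)) sums 0"
      using assms[of \<xi>] \<xi> by (subst sums_iff_shift) simp
    then have "(\<lambda>j. d (j + k) * \<xi> ^ (j + k) / \<xi> ^ k) sums (0 / \<xi> ^ k)"
      by (rule sums_divide)
    then show "(\<lambda>j. d (j + k) * \<xi> ^ j) sums 0" using \<xi> by (simp add: power_add)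
  qed simp
  then show ?case by (simp add: tendsto_const_iff)
qed

text \<open>The weights are specified only through their generating function; uniqueness carries
  sign properties over from an explicit formula for them.\<close>

lemma scheme_weights_unique:
  assumes "scheme_weights P \<tau> \<omega>" "scheme_weights P \<tau> \<omega>'"
  shows "\<omega> = \<omega>'"
proof
  fix k
  have "\<omega> k - \<omega>' k = 0"
  proof (rule powser_eq_0)
    fix \<xi> :: real assume "\<bar>\<xi>\<bar> < 1"
    then have "(\<lambda>j. \<omega> j * \<xi> ^ j - \<omega>' j * \<xi> ^ j) sums (P ((1 - \<xi>) / \<tau>) - P ((1 - \<xi>) / \<tau>))"
      using assms unfolding scheme_weights_def by (intro sums_diff) auto
    then show "(\<lambda>j. (\<omega> j - \<omega>' j) * \<xi> ^ j) sums 0" by (simp add: left_diff_distrib)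
  qed
  then show "\<omega> k = \<omega>' k" by simp
qed

section \<open>Signs of the weights for both types of characteristic function\<close>

lemma hoelder_continuous_on_imp_continuous_on:
  assumes "hoelder_continuous_on S f"
  shows "continuous_on S f"
proof -
  obtain \<gamma> C where h: "0 < \<gamma>" "\<And>x y. \<lbrakk>x \<in> S; y \<in> S\<rbrakk> \<Longrightarrow> \<bar>f x - f y\<bar> \<le> C * \<bar>x - y\<bar> powr \<gamma>"
    using assms unfolding hoelder_continuous_on_def by blast
  show ?thesis
    unfolding continuous_on_def
  proof
    fix x assume x: "x \<in> S"
    have lim: "((\<lambda>y. C * \<bar>y - x\<bar> powr \<gamma>) \<longlongrightarrow> 0) (at x within S)"
    proof -
      have "((\<lambda>y. \<bar>y - x\<bar>) \<longlongrightarrow> 0) (at x within S)"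
        by (auto intro!: tendsto_eq_intros)
      then have "((\<lambda>y. \<bar>y - x\<bar> powr \<gamma>) \<longlongrightarrow> 0) (at x within S)"
        using tendsto_powr'[of "\<lambda>y. \<bar>y - x\<bar>" 0 "at x within S" "\<lambda>_. \<gamma>" \<gamma>] h(1) by (auto simp: eventually_at_filter)
      then show ?thesis by (rule tendsto_mult_right_zero)
    qed
    show "(f \<longlongrightarrow> f x) (at x within S)"
      unfolding LIM_zero_iff[symmetric, of f "f x"]
      by (rule Lim_null_comparison[OF _ lim]) (use h(2) x in \<open>auto simp: eventually_at_filter\<close>)
  qed
qed

text \<open>In either case the weights are a sum or an integral over \<alpha> of
  \<open>frac_coeff j \<alpha>\<close> against a nonnegative density containing the factor
  \<open>\<tau> powr - \<alpha>\<close>, so both sign properties are inherited from the single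
  powers.\<close>

lemma characteristic_function_weights:
  assumes "characteristic_function P" "0 < \<tau>" "scheme_weights P \<tau> \<omega>"
  shows "\<forall>j>0. \<omega> j \<le> 0" "\<forall>n. 0 \<le> (\<Sum>j\<le>n. \<omega> j)"
proof -
  have "(\<forall>j>0. \<omega> j \<le> 0) \<and> (\<forall>n. 0 \<le> (\<Sum>j\<le>n. \<omega> j))"
    using assms(1) unfolding characteristic_function_def
  proof
    assume "multi_term P"
    then obtain m \<alpha> b where h: "m \<ge> 1" "0 < \<alpha> m" "\<forall>i\<in>{1..<m}. \<alpha> (i + 1) < \<alpha> i" "\<alpha> 1 < 1"
       "\<forall>i\<in>{1..m::nat}. (0::real) < b i" and P: "\<forall>z>0. P z = (\<Sum>i=1..m. b i * z powr \<alpha> i)"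
      unfolding multi_term_def by blast
    have \<alpha>: "\<alpha> i \<in> {0..1}" if "i \<in> {1..m}" for i
    proof -
      \<comment> \<open>The exponents decrease with the index, so all of them lie between
        \<open>\<alpha> m\<close> and \<open>\<alpha> 1\<close>.\<close>
      have anti: "\<alpha> j \<le> \<alpha> i" if "1 \<le> i" "i \<le> j" "j \<le> m" for i j
        using that(2,3)
      proof (induction j rule: dec_induct)
        case (step n)
        then show ?case using h(3) that(1) by (force dest!: bspec[of _ _ n])
      qed simp
      show ?thesis using anti[of 1 i] anti[of i m] that h by auto
    qed
    define a where "a j = (\<Sum>i=1..m. b i * \<tau> powr - \<alpha> i * frac_coeff j (\<alpha> i))" for j
    have "scheme_weights P \<tau> a"
      unfolding scheme_weights_def
    proof (intro allI impI)
      fix \<xi> :: real assume \<xi>: "\<bar>\<xi>\<bar> < 1"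
      have "(\<lambda>j. \<Sum>i=1..m. b i * (frac_coeff j (\<alpha> i) * \<xi> ^ j * \<tau> powr - \<alpha> i)) sums
            (\<Sum>i=1..m. b i * ((1 - \<xi>) / \<tau>) powr \<alpha> i)"
        by (intro sums_sum sums_mult frac_coeff_sums \<xi> assms)
      then show "(\<lambda>j. a j * \<xi> ^ j) sums P ((1 - \<xi>) / \<tau>)"
        using P \<xi> assms(2) by (simp add: a_def sum_distrib_right sum_distrib_left mult_ac)
    qed
    then have "\<omega> = a" using scheme_weights_unique assms(3) by blast
    moreover have "a j \<le> 0" if "j > 0" for j
      unfolding a_def using h(5) frac_coeff_nonpos[OF \<alpha> that]
      by (intro sum_nonpos mult_nonneg_nonpos mult_nonneg_nonneg) (auto simp: less_imp_le)
    moreover have "0 \<le> (\<Sum>j\<le>n. a j)" for n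
    proof -
      have "(\<Sum>j\<le>n. a j) = (\<Sum>i=1..m. b i * \<tau> powr - \<alpha> i * (\<Sum>j\<le>n. frac_coeff j (\<alpha> i)))"
        unfolding a_def by (subst sum.swap) (simp add: sum_distrib_left)
      also have "\<dots> \<ge> 0"
        using h(5) frac_coeff_sum_nonneg[OF \<alpha>]
        by (intro sum_nonneg[of "{1..m}"] mult_nonneg_nonneg) (auto simp: less_imp_le)
      finally show ?thesis .
    qed
    ultimately show ?thesis by blast
  next
    assume "distributed_order P"
    then obtain \<mu> where h: "\<forall>\<alpha>\<in>{0..1}. 0 \<le> \<mu> \<alpha>" "hoelder_continuous_on {0..1} \<mu>"
      and P: "\<forall>z>0. P z = integral {0..1} (\<lambda>\<alpha>. z powr \<alpha> * \<mu> \<alpha>)"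
      unfolding distributed_order_def by blast
    define w where "w \<alpha> = \<tau> powr - \<alpha> * \<mu> \<alpha>" for \<alpha>
    have w: "continuous_on {0..1} w" unfolding w_def
      using hoelder_continuous_on_imp_continuous_on[OF h(2)] assms(2) by (intro continuous_intros) auto
    have w0: "0 \<le> w \<alpha>" if "\<alpha> \<in> {0..1}" for \<alpha> using h(1) that by (auto simp: w_def)
    obtain B where B: "\<And>\<alpha>. \<alpha> \<in> {0..1} \<Longrightarrow> \<bar>w \<alpha>\<bar> \<le> B"
      using compact_imp_bounded[OF compact_continuous_image[OF w]] by (auto simp: bounded_iff simp del: atLeastAtMost_iff)
    have int: "(\<lambda>\<alpha>. frac_coeff j \<alpha> * w \<alpha>) integrable_on {0..1}" for j
      by (intro integrable_continuous_real continuous_intros continuous_on_frac_coeff w)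
    define a where "a j = integral {0..1} (\<lambda>\<alpha>. frac_coeff j \<alpha> * w \<alpha>)" for j
    have "scheme_weights P \<tau> a"
      unfolding scheme_weights_def
    proof (intro allI impI)
      fix \<xi> :: real assume \<xi>: "\<bar>\<xi>\<bar> < 1"
      define f where "f j \<alpha> = frac_coeff j \<alpha> * \<xi> ^ j * w \<alpha>" for j \<alpha>
      \<comment> \<open>Uniform convergence in \<alpha>, by the Weierstrass test with the geometric
        majorant below, permits termwise integration of the binomial series.\<close>
      have "uniform_limit {0..1} (\<lambda>n \<alpha>. \<Sum>j<n. f j \<alpha>) (\<lambda>\<alpha>. suminf (\<lambda>j. f j \<alpha>)) sequentially"
      proof (rule Weierstrass_m_test)
        fix j \<alpha> assume a: "\<alpha> \<in> {0..1::real}"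
        show "norm (f j \<alpha>) \<le> \<bar>\<xi>\<bar> ^ j * B"
          using mult_mono[OF frac_coeff_abs_le_1[OF a, of j] mult_left_mono[OF B[OF a], of "\<bar>\<xi>\<bar> ^ j"]]
          by (simp add: f_def abs_mult power_abs mult_ac)
      next
        show "summable (\<lambda>j. \<bar>\<xi>\<bar> ^ j * B)" using \<xi> by (intro summable_mult2 summable_geometric) simp
      qed
      moreover have "suminf (\<lambda>j. f j \<alpha>) = ((1 - \<xi>) / \<tau>) powr \<alpha> * \<mu> \<alpha>" for \<alpha>
        using sums_mult2[OF frac_coeff_sums[OF \<xi> assms(2)], of \<alpha> "\<mu> \<alpha>"]
        by (simp add: f_def w_def mult.assoc sums_unique[symmetric])
      ultimately have U: "uniform_limit {0..1} (\<lambda>n \<alpha>. \<Sum>j<n. f j \<alpha>) (\<lambda>\<alpha>. ((1 - \<xi>) / \<tau>) powr \<alpha> * \<mu> \<alpha>) sequentially"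
        by simp
      obtain I J where I: "\<And>n. ((\<lambda>\<alpha>. \<Sum>j<n. f j \<alpha>) has_integral I n) {0..1}"
        and J: "((\<lambda>\<alpha>. ((1 - \<xi>) / \<tau>) powr \<alpha> * \<mu> \<alpha>) has_integral J) {0..1}" and lim: "I \<longlonglongrightarrow> J"
        by (rule uniform_limit_integral[OF U])
           (auto simp: f_def intro!: continuous_intros continuous_on_frac_coeff w)
      have I_eq: "I = (\<lambda>n. \<Sum>j<n. a j * \<xi> ^ j)"
      proof (rule ext, rule has_integral_unique[OF I])
        fix n
        have "f j = (\<lambda>\<alpha>. frac_coeff j \<alpha> * w \<alpha> * \<xi> ^ j)" for j by (auto simp: f_def)
        then show "((\<lambda>\<alpha>. \<Sum>j<n. f j \<alpha>) has_integral (\<Sum>j<n. a j * \<xi> ^ j)) {0..1}"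
          unfolding a_def
          by (intro has_integral_sum) (auto intro!: has_integral_mult_left integrable_integral int)
      qed
      have "P ((1 - \<xi>) / \<tau>) = J"
        using P \<xi> assms(2) J by (simp add: integral_unique)
      then show "(\<lambda>j. a j * \<xi> ^ j) sums P ((1 - \<xi>) / \<tau>)"
        using lim unfolding I_eq by (simp add: sums_def)
    qed
    then have "\<omega> = a" using scheme_weights_unique assms(3) by blast
    moreover have "a j \<le> 0" if "j > 0" for j
    proof -
      have "a j \<le> integral {0..1} (\<lambda>_::real. 0)"
        unfolding a_def
        by (rule integral_le[OF int integrable_0]) (simp add: mult_nonpos_nonneg frac_coeff_nonpos[OF _ that] w0)
      then show ?thesis by simp
    qed
    moreover have "0 \<le> (\<Sum>j\<le>n. a j)" for n
    proof -
      have "(\<Sum>j\<le>n. a j) = integral {0..1} (\<lambda>\<alpha>. (\<Sum>j\<le>n. frac_coeff j \<alpha>) * w \<alpha>)"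
        unfolding a_def by (simp add: integral_sum int sum_distrib_right)
      also have "\<dots> \<ge> 0"
        by (rule Henstock_Kurzweil_Integration.integral_nonneg)
           (auto simp: sum_distrib_right int intro!: integrable_sum, auto simp flip: sum_distrib_right intro!: mult_nonneg_nonneg frac_coeff_sum_nonneg w0)
      finally show ?thesis .
    qed
    ultimately show ?thesis by blast
  qed
  then show "\<forall>j>0. \<omega> j \<le> 0" "\<forall>n. 0 \<le> (\<Sum>j\<le>n. \<omega> j)" by auto
qed

section \<open>Positivity and growth of the characteristic function\<close>

lemma continuous_nonneg_integral_pos:
  fixes f :: "real \<Rightarrow> real"
  assumes "continuous_on {a..b} f" "\<And>x. x \<in> {a..b} \<Longrightarrow> 0 \<le> f x" "a < b" "x \<in> {a..b}" "0 < f x"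
  shows "0 < integral {a..b} f"
proof -
  have "integral {a..b} f \<noteq> 0"
    using integral_eq_0_iff[OF assms(1,3,2)] assms(4,5) by force
  moreover have "0 \<le> integral {a..b} f"
    using assms by (intro Henstock_Kurzweil_Integration.integral_nonneg integrable_continuous_real) auto
  ultimately show ?thesis by simp
qed

text \<open>Growth like a positive power lets P(1/\<tau>) exceed every bound for small \<tau>. For a
  finite sum, keeping the last term suffices; for an integral, the range is cut down to [1/2, 1],
  where \<open>z powr (1/2)\<close> bounds the power from below and the mass of \<mu> is positive
  because \<open>\<mu> 1\<close> is.\<close>

lemma characteristic_function_lower_bound:
  assumes "characteristic_function P"
  obtains c \<beta> where "0 < c" "0 < \<beta>" "\<And>z. 1 \<le> z \<Longrightarrow> c * z powr \<beta> \<le> P z"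
  using assms unfolding characteristic_function_def
proof
  assume "multi_term P"
  then obtain m \<alpha> b where h: "m \<ge> 1" "0 < \<alpha> m" 
     "\<forall>i\<in>{1..m::nat}. (0::real) < b i" and P: "\<forall>z>0. P z = (\<Sum>i=1..m. b i * z powr \<alpha> i)"
    unfolding multi_term_def by blast
  show ?thesis
  proof (rule that)
    show "b m * z powr \<alpha> m \<le> P z" if "1 \<le> z" for z
    proof -
      have "b m * z powr \<alpha> m \<le> (\<Sum>i=1..m. b i * z powr \<alpha> i)"
        using h by (intro member_le_sum) (auto simp: less_imp_le)
      then show ?thesis using P that by simp
    qed
  qed (use h in auto)
next
  assume "distributed_order P"
  then obtain \<mu> where h: "\<forall>\<alpha>\<in>{0..1}. 0 \<le> \<mu> \<alpha>" "hoelder_continuous_on {0..1} \<mu>" "0 < \<mu> 0 * \<mu> 1"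
    and P: "\<forall>z>0. P z = integral {0..1} (\<lambda>\<alpha>. z powr \<alpha> * \<mu> \<alpha>)"
    unfolding distributed_order_def by blast
  have \<mu>: "continuous_on {0..1} \<mu>" using hoelder_continuous_on_imp_continuous_on[OF h(2)] .
  have \<mu>2: "continuous_on {1/2..1} \<mu>" by (rule continuous_on_subset[OF \<mu>]) auto
  show ?thesis
  proof (rule that)
    have "\<mu> 1 > 0" using h(1,3) by (auto simp: zero_less_mult_iff dest!: bspec[of _ _ 0])
    then show "0 < integral {1/2..1} \<mu>"
      using h(1) \<mu>2 by (intro continuous_nonneg_integral_pos[where x = 1]) auto
    show "integral {1/2..1} \<mu> * z powr (1/2) \<le> P z" if z: "1 \<le> z" for z
    proof -
      have c: "continuous_on {0..1} (\<lambda>\<alpha>. z powr \<alpha> * \<mu> \<alpha>)"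
        using z by (intro continuous_intros \<mu>) auto
      have i: "(\<lambda>\<alpha>. z powr \<alpha> * \<mu> \<alpha>) integrable_on {1/2..1}"
        by (rule integrable_continuous_real, rule continuous_on_subset[OF c]) auto
      have "integral {1/2..1} \<mu> * z powr (1/2) = integral {1/2..1} (\<lambda>\<alpha>. \<mu> \<alpha> * z powr (1/2))"
        by simp
      also have "\<dots> \<le> integral {1/2..1} (\<lambda>\<alpha>. z powr \<alpha> * \<mu> \<alpha>)"
      proof (rule integral_le)
        show "(\<lambda>\<alpha>. \<mu> \<alpha> * z powr (1/2)) integrable_on {1/2..1}"
          by (intro integrable_continuous_real continuous_intros \<mu>2)
      next
        fix \<alpha> assume "\<alpha> \<in> {1/2..1::real}"
        then show "\<mu> \<alpha> * z powr (1/2) \<le> z powr \<alpha> * \<mu> \<alpha>"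
          using h(1) z by (subst mult.commute) (intro mult_right_mono powr_mono, auto)
      qed (rule i)
      also have "\<dots> \<le> integral {0..1} (\<lambda>\<alpha>. z powr \<alpha> * \<mu> \<alpha>)"
        by (rule integral_subset_le) (use i c h(1) in \<open>auto intro: integrable_continuous_real\<close>)
      finally show ?thesis using P z by simp
    qed
  qed auto
qed

lemma characteristic_function_pos:
  assumes "characteristic_function P" "0 < z"
  shows "0 < P z"
  using assms(1) unfolding characteristic_function_def
proof
  assume "multi_term P"
  then show ?thesis unfolding multi_term_def using assms(2) by (force intro: sum_pos)
next
  assume "distributed_order P"
  then obtain \<mu> where h: "\<forall>\<alpha>\<in>{0..1}. 0 \<le> \<mu> \<alpha>" "hoelder_continuous_on {0..1} \<mu>" "0 < \<mu> 0 * \<mu> 1"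
    and P: "\<forall>z>0. P z = integral {0..1} (\<lambda>\<alpha>. z powr \<alpha> * \<mu> \<alpha>)"
    unfolding distributed_order_def by blast
  have "\<mu> 0 > 0" using h(1,3) by (auto simp: zero_less_mult_iff dest!: bspec[of _ _ 0])
  then have "0 < integral {0..1} (\<lambda>\<alpha>. z powr \<alpha> * \<mu> \<alpha>)"
    using h(1) assms(2)
    by (intro continuous_nonneg_integral_pos[where x = 0] continuous_intros
          hoelder_continuous_on_imp_continuous_on[OF h(2)]) auto
  then show ?thesis using P assms(2) by simp
qed

section \<open>Lumped systems with positive semidefinite stiffness matrix\<close>

text \<open>The inequality is tested with the negative part \<open>y\<close> of \<open>x\<close>.
  Since \<open>x + y\<close> is the positive part, with support disjoint from that of
  \<open>y\<close>, the off-diagonal signs give \<open>y \<bullet> (A *v (x + y)) \<le> 0\<close>.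
  With \<open>0 \<le> y \<bullet> (A *v x)\<close> this leaves
  \<open>y \<bullet> (A *v y) \<le> 0\<close>, and definiteness forces \<open>y = 0\<close>.\<close>

lemma stieltjes_matrix_monotone:
  fixes A :: "real^'n^'n"
  assumes off: "\<And>i j. i \<noteq> j \<Longrightarrow> A $ i $ j \<le> 0"
    and pd: "\<And>x. x \<noteq> 0 \<Longrightarrow> 0 < x \<bullet> (A *v x)"
    and Ax: "\<And>i. 0 \<le> (A *v x) $ i"
  shows "0 \<le> x $ i"
proof -
  define y where "y = (\<chi> i. max (- x $ i) 0)"
  have "y \<bullet> (A *v (x + y)) = (\<Sum>i\<in>UNIV. \<Sum>j\<in>UNIV. y $ i * (A $ i $ j * (x + y) $ j))"
    by (simp add: inner_vec_def matrix_vector_mult_def sum_distrib_left)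
  also have "\<dots> \<le> 0"
  proof (intro sum_nonpos)
    fix i j
    have "0 \<le> y $ i" "0 \<le> (x + y) $ j" "y $ i * (x + y) $ i = 0" by (auto simp: y_def max_def)
    then show "y $ i * (A $ i $ j * (x + y) $ j) \<le> 0"
      using off[of i j] by (cases "i = j") (auto simp: mult_nonneg_nonpos mult_nonpos_nonneg)
  qed
  finally have "y \<bullet> (A *v y) \<le> - (y \<bullet> (A *v x))"
    by (simp add: matrix_vector_right_distrib inner_add_right)
  moreover have "0 \<le> y \<bullet> (A *v x)"
    unfolding inner_vec_def using Ax by (intro sum_nonneg) (simp add: y_def)
  ultimately have "y = 0" using pd[of y] by fastforce
  then have "y $ i = 0" by simp
  then show ?thesis by (simp add: y_def max_def split: if_splits)
qed

section \<open>Time stepping with a positive diagonal mass matrix\<close>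

lemma matrix_mult_matrix_inv:
  fixes A :: "real^'n^'n"
  assumes "invertible A"
  shows "A ** matrix_inv A = mat 1"
  using someI_ex[OF assms[unfolded invertible_def]] by (simp add: matrix_inv_def)

lemma matrix_inv_mult_vec:
  fixes A :: "real^'n^'n"
  assumes "invertible A"
  shows "A *v (matrix_inv A *v x) = x"
  using assms by (simp add: matrix_vector_mul_assoc matrix_mult_matrix_inv)

lemma invertible_if_injective:
  fixes A :: "real^'n^'n"
  assumes "\<And>x. A *v x = 0 \<Longrightarrow> x = 0"
  shows "invertible A"
  using assms matrix_left_invertible_ker[of A] invertible_left_inverse[of A] by blast

text \<open>Collects the mesh-independent facts about the two matrices: a positive diagonal mass
  matrix and a positive semidefinite stiffness matrix.\<close>

locale lumped =
  fixes M S H :: "real^'n^'n" and m :: "'n \<Rightarrow> real"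
  assumes M_eq: "M = (\<chi> i j. if i = j then m i else 0)" and m_pos: "0 < m i"
    and S_psd: "0 \<le> x \<bullet> (S *v x)"
    and H_eq: "H = matrix_inv M ** S"
begin

lemma M_mult: "(M *v x) $ i = m i * x $ i"
  by (simp add: M_eq matrix_vector_mult_def if_distrib[of "\<lambda>c. c * _"] cong: if_cong)

lemma M_mult_H: "M ** H = S"
proof -
  have "invertible M"
  proof (rule invertible_if_injective)
    fix x assume "M *v x = 0"
    then have "m i * x $ i = 0" for i by (metis M_mult zero_index)
    then show "x = 0" using m_pos by (simp add: vec_eq_iff) (metis less_irrefl)
  qed
  then show ?thesis by (simp add: H_eq matrix_mul_assoc matrix_mult_matrix_inv)
qed

lemma M_pd:
  assumes "x \<noteq> 0"
  shows "0 < x \<bullet> (M *v x)"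
proof -
  obtain i where "x $ i \<noteq> 0" using assms by (auto simp: vec_eq_iff)
  moreover have "x \<bullet> (M *v x) = (\<Sum>i\<in>UNIV. m i * (x $ i)\<^sup>2)"
    by (simp add: inner_vec_def M_mult power2_eq_square mult_ac)
  ultimately show ?thesis
    by (auto intro!: sum_pos2[of _ i] simp: m_pos less_imp_le)
qed

definition shifted :: "real \<Rightarrow> real^'n^'n" where
  "shifted w = w *\<^sub>R mat 1 + H"

text \<open>Multiplication by \<open>M\<close> clears the inverse hidden in \<open>H\<close> and
  leads to \<open>w *\<^sub>R M + S\<close>, which is positive definite for positive
  \<open>w\<close> and has the off-diagonal entries of \<open>S\<close>.\<close>

lemma M_mult_shifted: "M *v (shifted w *v x) = (w *\<^sub>R M + S) *v x"
proof -
  have "shifted w *v x = w *\<^sub>R x + H *v x"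
    by (simp add: shifted_def matrix_vector_mult_add_rdistrib scaleR_matrix_vector_assoc[symmetric])
  then show ?thesis
    by (simp add: matrix_vector_mult_add_rdistrib scaleR_matrix_vector_assoc[symmetric]
        matrix_vector_right_distrib matrix_vector_mul_assoc M_mult_H matrix_vector_mult_scaleR)
qed

lemma energy_pd:
  assumes "0 < w" "x \<noteq> 0"
  shows "0 < x \<bullet> ((w *\<^sub>R M + S) *v x)"
  using assms M_pd[OF assms(2)] S_psd[of x]
  by (simp add: matrix_vector_mult_add_rdistrib scaleR_matrix_vector_assoc[symmetric] inner_add_right add_pos_nonneg)

text \<open>Positive definiteness of \<open>w *\<^sub>R M + S\<close> makes \<open>shifted w\<close>
  injective, so that \<open>matrix_inv\<close> yields a genuine inverse.\<close>

lemma shifted_inverse: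
  assumes "0 < w"
  shows "(w *\<^sub>R M + S) *v (matrix_inv (shifted w) *v b) = M *v b"
proof -
  have "invertible (shifted w)"
  proof (rule invertible_if_injective)
    fix x assume "shifted w *v x = 0"
    then have "(w *\<^sub>R M + S) *v x = 0" using M_mult_shifted[of w x] by simp
    then show "x = 0" using energy_pd[OF assms, of x] by force
  qed
  then show ?thesis using M_mult_shifted[symmetric] matrix_inv_mult_vec by metis
qed

lemma shifted_inverse_nonneg:
  assumes "\<And>i j. i \<noteq> j \<Longrightarrow> S $ i $ j \<le> 0" "0 < w" "\<And>i. 0 \<le> b $ i"
  shows "0 \<le> (matrix_inv (shifted w) *v b) $ i"
proof (rule stieltjes_matrix_monotone[of "w *\<^sub>R M + S"])
  show "(w *\<^sub>R M + S) $ i $ j \<le> 0" if "i \<noteq> j" for i j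
    using assms(1)[OF that] that by (simp add: M_eq)
  show "0 < x \<bullet> ((w *\<^sub>R M + S) *v x)" if "x \<noteq> 0" for x
    using energy_pd[OF assms(2) that] .
  show "0 \<le> ((w *\<^sub>R M + S) *v (matrix_inv (shifted w) *v b)) $ i" for i
    using assms(3) less_imp_le[OF m_pos] by (simp add: shifted_inverse[OF assms(2)] M_mult)
qed

text \<open>By induction the right-hand side of each step is nonnegative: \<open>V\<close> carries a
  nonnegative partial sum of the weights, and the subtracted earlier iterates carry the nonpositive
  weights \<open>\<omega> (n - j)\<close> with \<open>n - j > 0\<close>. The inverse then preserves
  nonnegativity.\<close>

lemma discrete_solution_nonneg:
  assumes S: "\<And>i j. i \<noteq> j \<Longrightarrow> S $ i $ j \<le> 0"
    and w: "0 < \<omega> 0" "\<And>j. 0 < j \<Longrightarrow> \<omega> j \<le> 0" "\<And>n. 0 \<le> (\<Sum>j\<le>n. \<omega> j)"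
    and V: "\<And>i. 0 \<le> V $ i"
  shows "0 \<le> discrete_solution \<omega> H V n $ i"
proof (induction n arbitrary: i rule: less_induct)
  case (less n)
  show ?case
  proof (cases n)
    case 0
    then show ?thesis using V by (simp add: discrete_solution.simps)
  next
    case (Suc k)
    have "0 \<le> ((\<Sum>j\<in>{0..<n}. \<omega> j *\<^sub>R V) -
        (\<Sum>j\<in>{1..<n}. \<omega> (n - j) *\<^sub>R discrete_solution \<omega> H V j)) $ i" for i
    proof -
      have "(\<Sum>j\<in>{0..<n}. \<omega> j *\<^sub>R V) = (\<Sum>j\<le>k. \<omega> j) *\<^sub>R V"
        by (simp add: scaleR_sum_left Suc atLeast0LessThan lessThan_Suc_atMost)
      moreover have "0 \<le> ((\<Sum>j\<le>k. \<omega> j) *\<^sub>R V) $ i"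
        using w(3) V by simp
      moreover have "(\<Sum>j\<in>{1..<n}. \<omega> (n - j) *\<^sub>R discrete_solution \<omega> H V j) $ i \<le> 0"
        using w(2) less by (auto simp: intro!: sum_nonpos mult_nonpos_nonneg)
      ultimately show ?thesis by simp
    qed
    then show ?thesis
      using shifted_inverse_nonneg[OF S w(1)] Suc
      by (subst discrete_solution.simps) (simp add: shifted_def)
  qed
qed

text \<open>With \<open>x = w (w I + H)\<^sup>-\<^sup>1 e\<^sub>j\<close> and \<open>y = x - e\<^sub>j\<close> the energy identity gives
  \<open>\<bar>y\<bar> = O(1/w)\<close>. Since \<open>y\<^sub>i = x\<^sub>i \<ge> 0\<close>, row \<open>i\<close> of \<open>(w M + S) y = - S e\<^sub>j\<close> then reads
  \<open>s\<^sub>i\<^sub>j \<le> O(1/w)\<close>.\<close>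

lemma off_diagonal_nonpos:
  assumes "i \<noteq> j"
    and nn: "\<And>L. \<exists>w>L. 0 \<le> (matrix_inv (shifted w) *v (w *\<^sub>R axis j 1)) $ i"
  shows "S $ i $ j \<le> 0"
proof (rule ccontr)
  assume "\<not> S $ i $ j \<le> 0"
  then have s: "0 < S $ i $ j" by simp
  define \<mu> where "\<mu> = Min (range m)"
  have \<mu>: "0 < \<mu>" "\<And>i. \<mu> \<le> m i" using m_pos by (auto simp: \<mu>_def)
  obtain K where K: "0 < K" "\<And>y. norm (S *v y) \<le> K * norm y"
    using bounded_linear.pos_bounded[OF matrix_vector_mul_bounded_linear[of S]] by (auto simp: mult.commute)
  define e where "e = (axis j 1 :: real^'n)"
  define C where "C = K * norm (S *v e) / \<mu>"
  \<comment> \<open>The argument ends in \<open>S $ i $ j \<le> C / w\<close>, which this choice of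
    \<open>w\<close> contradicts.\<close>
  obtain w where w: "w > max 0 (C / S $ i $ j)" 
    and xi: "0 \<le> (matrix_inv (shifted w) *v (w *\<^sub>R e)) $ i"
    using nn unfolding e_def by blast
  have w0: "0 < w" using w by simp
  define x where "x = matrix_inv (shifted w) *v (w *\<^sub>R e)"
  define y where "y = x - e"
  have "(w *\<^sub>R M + S) *v x = w *\<^sub>R (M *v e)"
    unfolding x_def by (simp add: shifted_inverse[OF w0] matrix_vector_mult_scaleR)
  then have eq: "w *\<^sub>R (M *v y) + S *v y = - (S *v e)"
    by (simp add: y_def matrix_vector_mult_diff_distrib matrix_vector_mult_add_rdistrib
        scaleR_matrix_vector_assoc[symmetric] algebra_simps)
  \<comment> \<open>Testing the equation for \<open>y\<close> with \<open>y\<close> itself: the mass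
    term is coercive with constant \<mu> and the stiffness term is nonnegative.\<close>
  have "\<mu> * (y \<bullet> y) \<le> y \<bullet> (M *v y)"
    unfolding inner_vec_def sum_distrib_left
    by (intro sum_mono) (use \<mu>(2) in \<open>simp add: M_mult mult.left_commute mult_right_mono\<close>)
  then have "w * (\<mu> * (y \<bullet> y)) \<le> w * (y \<bullet> (M *v y)) + y \<bullet> (S *v y)"
    using w0 S_psd[of y] by (smt (verit) mult_left_mono)
  also have "\<dots> = y \<bullet> (w *\<^sub>R (M *v y) + S *v y)" by (simp add: inner_add_right)
  also have "\<dots> \<le> norm y * norm (S *v e)"
    unfolding eq using norm_cauchy_schwarz[of y "- (S *v e)"] by simp
  finally have "norm y * (w * \<mu> * norm y) \<le> norm y * norm (S *v e)"
    by (simp add: dot_square_norm power2_eq_square mult_ac)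
  then have "w * \<mu> * norm y \<le> norm (S *v e)" by (cases "y = 0") auto
  then have yb: "K * norm y \<le> C / w"
    using \<mu>(1) w0 K(1) by (simp add: C_def field_simps)
  have "S $ i $ j = (S *v e) $ i"
    by (simp add: e_def matrix_vector_mul_component matrix_vector_mult_basis column_def)
  also have "\<dots> = - (w * (m i * y $ i)) - (S *v y) $ i"
    using arg_cong[OF eq, of "\<lambda>v. v $ i"] by (simp add: M_mult)
  also have "\<dots> \<le> - (S *v y) $ i"
  proof -
    have "0 \<le> y $ i" using xi assms(1) by (simp add: y_def x_def e_def axis_def)
    then show ?thesis using w0 m_pos[of i] by simp
  qed
  also have "\<dots> \<le> K * norm y"
    using component_le_norm_cart[of "S *v y" i] K(2)[of y] by simp
  also note yb
  finally have "w \<le> C / S $ i $ j" using s w0 by (simp add: field_simps)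
  then show False using w by simp
qed

end

section \<open>Triangles in the plane\<close>

text \<open>Twice the signed area of the triangle spanned by the two vectors; the sign tells on
  which side of the line along \<open>u\<close> the vector \<open>v\<close> points.\<close>

definition det2 :: "real^2 \<Rightarrow> real^2 \<Rightarrow> real" where
  "det2 u v = u $ 1 * v $ 2 - u $ 2 * v $ 1"

lemma inner_real2: "u \<bullet> v = u $ 1 * v $ 1 + u $ 2 * v $ (2::2)" for u v :: "real^2"
  by (simp add: inner_vec_def sum_2)

lemma lagrange_identity_real2: "(det2 u v)\<^sup>2 + (u \<bullet> v)\<^sup>2 = (norm u)\<^sup>2 * (norm v)\<^sup>2"
  unfolding power2_norm_eq_inner det2_def inner_real2 by (simp add: power2_eq_square algebra_simps)

text \<open>Both angles are compared through \<open>arcsin x = arctan (x / sqrt (1 - x\<^sup>2))\<close> with \<open>x\<close> the cosine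
  of the angle; the quotients are the cotangents.\<close>

lemma angle_sum_le_pi_iff:
  assumes "det2 (a - c) (b - c) \<noteq> 0" "det2 (a - d) (b - d) \<noteq> 0"
  shows "angle_at c a b + angle_at d a b \<le> pi \<longleftrightarrow>
    0 \<le> ((a - c) \<bullet> (b - c)) / \<bar>det2 (a - c) (b - c)\<bar> + ((a - d) \<bullet> (b - d)) / \<bar>det2 (a - d) (b - d)\<bar>"
proof -
  have angle: "angle_at c a b = pi / 2 - arctan ((a - c) \<bullet> (b - c) / \<bar>det2 (a - c) (b - c)\<bar>)"
    if nz: "det2 (a - c) (b - c) \<noteq> 0" for c
  proof -
    define u v where "u = a - c" and "v = b - c"
    define n x where "n = norm u * norm v" and "x = (u \<bullet> v) / n"
    have D: "(det2 u v)\<^sup>2 = n\<^sup>2 - (u \<bullet> v)\<^sup>2" and D0: "0 < (det2 u v)\<^sup>2"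
      using lagrange_identity_real2[of u v] nz by (auto simp: n_def u_def v_def power_mult_distrib)
    have "n \<noteq> 0"
      using D D0 by auto
    then have n: "0 < n" unfolding n_def by (simp add: zero_less_mult_iff less_le)
    have sq: "1 - x\<^sup>2 = (det2 u v)\<^sup>2 / n\<^sup>2"
      using n D by (simp add: x_def field_simps)
    then have "x\<^sup>2 < 1" using D0 n by (smt (verit) divide_pos_pos zero_less_power)
    then have x: "-1 < x" "x < 1" by (auto simp: abs_square_less_1 abs_less_iff)
    have "sqrt (1 - x\<^sup>2) = \<bar>det2 u v\<bar> / n"
      unfolding sq using n by (simp add: real_sqrt_divide)
    then have "x / sqrt (1 - x\<^sup>2) = (u \<bullet> v) / \<bar>det2 u v\<bar>"
      using n by (simp add: x_def)
    then have "arcsin x = arctan ((u \<bullet> v) / \<bar>det2 u v\<bar>)" using arcsin_arctan[OF x] by simp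
    moreover have "angle_at c a b = pi / 2 - arcsin x"
      using arccos_arcsin_eq[of x] x by (simp add: angle_at_def x_def n_def u_def v_def)
    ultimately show ?thesis by (simp add: u_def v_def)
  qed
  define s t where "s = ((a - c) \<bullet> (b - c)) / \<bar>det2 (a - c) (b - c)\<bar>"
    and "t = ((a - d) \<bullet> (b - d)) / \<bar>det2 (a - d) (b - d)\<bar>"
  \<comment> \<open>Each angle is \<pi>/2 minus the arctangent of its cotangent, so the condition
    says that the two arctangents have a nonnegative sum; oddness and monotonicity then remove
    them.\<close>
  have "angle_at c a b + angle_at d a b \<le> pi \<longleftrightarrow> arctan (- t) \<le> arctan s"
    using angle[OF assms(1)] angle[OF assms(2)] by (auto simp: s_def t_def arctan_minus)
  also have "\<dots> \<longleftrightarrow> 0 \<le> s + t" by (auto simp: arctan_le_iff)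
  finally show ?thesis by (simp add: s_def t_def)
qed

text \<open>Cramer's rule expresses the components of \<open>g\<close> through its inner products
  with \<open>u\<close> and \<open>v\<close>.\<close>

lemma real2_eq_0_if_orthogonal:
  assumes "det2 u v \<noteq> 0" "g \<bullet> u = 0" "g \<bullet> v = 0"
  shows "g = 0"
proof -
  have "g $ 1 * det2 u v = v $ 2 * (g \<bullet> u) - u $ 2 * (g \<bullet> v)"
    "g $ 2 * det2 u v = u $ 1 * (g \<bullet> v) - v $ 1 * (g \<bullet> u)"
    by (simp_all add: det2_def inner_real2 algebra_simps)
  then show ?thesis using assms by (simp add: vec_eq_iff forall_2)
qed

text \<open>The vectors \<open>g\<close> and \<open>h\<close> form the basis dual to
  \<open>u\<close>, \<open>v\<close>. This is how the gradients of two nodal functions on a triangle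
  relate to the edge vectors issuing from the third vertex.\<close>

lemma inner_dual_basis_real2:
  assumes "g \<bullet> u = 1" "g \<bullet> v = 0" "h \<bullet> u = 0" "h \<bullet> v = 1"
  shows "(h \<bullet> g) * (det2 u v)\<^sup>2 = - (u \<bullet> v)"
proof -
  have g: "g $ 1 * det2 u v = v $ 2 * (g \<bullet> u) - u $ 2 * (g \<bullet> v)"
    "g $ 2 * det2 u v = u $ 1 * (g \<bullet> v) - v $ 1 * (g \<bullet> u)" for g
    by (simp_all add: det2_def inner_real2 algebra_simps)
  have "(h \<bullet> g) * (det2 u v)\<^sup>2 = (h $ 1 * det2 u v) * (g $ 1 * det2 u v) + (h $ 2 * det2 u v) * (g $ 2 * det2 u v)"
    by (simp add: inner_real2 power2_eq_square algebra_simps)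
  also have "\<dots> = - (u \<bullet> v)"
    unfolding g assms by (simp add: inner_real2)
  finally show ?thesis .
qed

lemma content_triangle_det2: "measure lebesgue (convex hull {a, b, c}) = \<bar>det2 (a - c) (b - c)\<bar> / 2"
proof -
  have "measure lebesgue (convex hull {a, b, c}) = measure lborel (convex hull {a, b, c})"
    by (intro measure_completion) (simp add: borel_compact finite_imp_compact_convex_hull)
  also have "\<dots> = measure lborel (convex hull {c, a, b})" by (simp add: insert_commute)
  also have "\<dots> = \<bar>- det2 (a - c) (b - c)\<bar> / 2"
    unfolding content_triangle by (simp add: det2_def mult.commute)
  finally show ?thesis by simp
qed

text \<open>A point slightly off the midpoint of the common edge, moved towards \<open>c\<close>, is
  interior to the first triangle and still belongs to the second.\<close>

lemma same_side_triangles_overlap: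
  assumes nc: "\<not> collinear {a, b, c}" and pos: "0 < det2 (b - a) (c - a) * det2 (b - a) (d - a)"
  shows "interior (convex hull {a, b, c}) \<inter> convex hull {a, b, d} \<noteq> {}"
proof -
  define D where "D = det2 (b - a) (d - a)"
  \<comment> \<open>Cramer coordinates of \<open>c - a\<close> in the basis \<open>b - a\<close>,
    \<open>d - a\<close>; being on the same side means that \<gamma> is positive.\<close>
  define \<gamma> \<beta> where "\<gamma> = det2 (b - a) (c - a) / D" and "\<beta> = det2 (c - a) (d - a) / D"
  \<comment> \<open>Small enough that the barycentric coordinates of the point stay nonnegative in
    both triangles.\<close>
  define \<epsilon> where "\<epsilon> = 1 / (4 * (1 + \<bar>\<beta>\<bar> + \<gamma>))"
  have D: "D \<noteq> 0" and \<gamma>: "0 < \<gamma>"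
    using pos by (auto simp: D_def \<gamma>_def zero_less_mult_iff zero_less_divide_iff)
  have c: "c - a = \<beta> *\<^sub>R (b - a) + \<gamma> *\<^sub>R (d - a)"
  proof -
    have "(c - a) $ i = \<beta> * (b - a) $ i + \<gamma> * (d - a) $ i" for i
    proof -
      have "D * (c - a) $ i = det2 (c - a) (d - a) * (b - a) $ i + det2 (b - a) (c - a) * (d - a) $ i"
        using exhaust_2[of i] by (auto simp: D_def det2_def algebra_simps)
      then have "(c - a) $ i = (det2 (c - a) (d - a) * (b - a) $ i + det2 (b - a) (c - a) * (d - a) $ i) / D"
        using D by (simp add: nonzero_eq_divide_eq mult.commute)
      then show ?thesis by (simp add: \<beta>_def \<gamma>_def add_divide_distrib)
    qed
    then show ?thesis by (simp add: vec_eq_iff)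
  qed
  have p: "0 < 4 * (1 + \<bar>\<beta>\<bar> + \<gamma>)" using \<gamma> by (simp add: add_pos_pos add_nonneg_pos)
  then have e0: "0 < \<epsilon>" by (simp add: \<epsilon>_def)
  have "\<epsilon> * (4 * (1 + \<bar>\<beta>\<bar> + \<gamma>)) = 1" using p by (simp add: \<epsilon>_def)
  then have e: "4 * \<epsilon> + 4 * (\<epsilon> * \<bar>\<beta>\<bar>) + 4 * (\<epsilon> * \<gamma>) = 1" by (simp add: algebra_simps)
  have eb: "\<bar>\<epsilon> * \<beta>\<bar> = \<epsilon> * \<bar>\<beta>\<bar>" "0 < \<epsilon> * \<gamma>" "0 \<le> \<epsilon> * \<bar>\<beta>\<bar>" using e0 \<gamma> by (simp_all add: abs_mult)
  define x where "x = a + (1/2) *\<^sub>R (b - a) + \<epsilon> *\<^sub>R (c - a)"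
  have "x = (1/2 - \<epsilon>) *\<^sub>R a + (1/2) *\<^sub>R b + \<epsilon> *\<^sub>R c"
    unfolding x_def by (simp add: vec_eq_iff algebra_simps)
  moreover have "0 < 1/2 - \<epsilon>" using e eb by linarith
  moreover have "interior (convex hull {a, b, c}) =
      {v. \<exists>x y z. 0 < x \<and> 0 < y \<and> 0 < z \<and> x + y + z = 1 \<and> x *\<^sub>R a + y *\<^sub>R b + z *\<^sub>R c = v}"
    by (rule interior_convex_hull_3_minimal[OF nc]) simp
  ultimately have "x \<in> interior (convex hull {a, b, c})"
    using e0 by (simp only:) (intro CollectI exI[of _ "1/2 - \<epsilon>"] exI[of _ "1/2"] exI[of _ \<epsilon>], simp)
  moreover have "x \<in> convex hull {a, b, d}"
  proof -
    have "x = (1/2 - \<epsilon> * \<beta> - \<epsilon> * \<gamma>) *\<^sub>R a + (1/2 + \<epsilon> * \<beta>) *\<^sub>R b + (\<epsilon> * \<gamma>) *\<^sub>R d"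
      unfolding x_def c by (simp add: vec_eq_iff algebra_simps)
    moreover have "0 \<le> 1/2 - \<epsilon> * \<beta> - \<epsilon> * \<gamma>" "0 \<le> 1/2 + \<epsilon> * \<beta>" using e eb e0 by linarith+
    ultimately show ?thesis unfolding convex_hull_3 using eb by (auto intro!: exI)
  qed
  ultimately show ?thesis by blast
qed

section \<open>Triangles as two-dimensional simplices\<close>

lemma two_simplex_triangle:
  assumes "2 simplex (convex hull {a, b, c :: real^2})"
  shows "\<not> affine_dependent {a, b, c}" "card {a, b, c} = 3"
proof -
  have "aff_dim {a, b, c} = 2"
    using aff_dim_simplex[OF assms] by (simp add: aff_dim_convex_hull)
  moreover have "card {a, b, c} \<le> 3" by (simp add: card_insert_le_m1)
  ultimately show "card {a, b, c} = 3" using aff_dim_le_card[of "{a, b, c}"] by simp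
  then show "\<not> affine_dependent {a, b, c}"
    using \<open>aff_dim {a, b, c} = 2\<close> by (simp add: affine_independent_iff_card)
qed

lemma two_simplex_not_collinear:
  assumes "2 simplex (convex hull {a, b, c :: real^2})"
  shows "\<not> collinear {a, b, c}"
  using two_simplex_triangle[OF assms] by (auto simp: collinear_3_eq_affine_dependent card_insert_if split: if_splits)

text \<open>A vanishing determinant would mean zero area, whereas the centroid is an interior
  point.\<close>

lemma two_simplex_det2:
  assumes "2 simplex (convex hull {a, b, c :: real^2})"
  shows "det2 (a - c) (b - c) \<noteq> 0"
proof
  assume 0: "det2 (a - c) (b - c) = 0"
  have "convex hull {a, b, c} \<in> lmeasurable"
    by (intro lmeasurable_compact finite_imp_compact_convex_hull) simp
  then have "negligible (convex hull {a, b, c})"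
    using 0 by (simp add: negligible_iff_measure0 content_triangle_det2)
  moreover have "interior (convex hull {a, b, c}) \<noteq> {}"
    using interior_convex_hull_3_minimal[OF two_simplex_not_collinear[OF assms]]
    by (auto intro!: exI[of _ "1/3::real"])
  ultimately show False
    by (metis interior_subset negligible_subset open_interior open_not_negligible)
qed

lemma vertices_triangle:
  assumes "2 simplex (convex hull {a, b, c :: real^2})"
  shows "vertices (convex hull {a, b, c}) = {a, b, c}"
  using extreme_point_of_convex_hull_affine_independent[OF two_simplex_triangle(1)[OF assms]]
  by (auto simp: vertices_def)

lemma two_simplex_vertices:
  assumes "2 simplex (K :: (real^2) set)"
  shows "card (vertices K) = 3" "K = convex hull (vertices K)"
proof -
  obtain C where C: "\<not> affine_dependent C" "int (card C) = 2 + 1" "K = convex hull C"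
    using assms unfolding simplex_def by blast
  then have "vertices K = C"
    using extreme_point_of_convex_hull_affine_independent by (auto simp: vertices_def)
  then show "card (vertices K) = 3" "K = convex hull (vertices K)" using C by auto
qed

lemma two_simplex_obtain_apex:
  assumes "2 simplex K" "a \<in> vertices K" "b \<in> vertices K" "a \<noteq> b"
  obtains c where "K = convex hull {a, b, c}"
proof -
  have "card (vertices K - {a, b}) = 1"
    using two_simplex_vertices(1)[OF assms(1)] assms by (simp add: card_Diff_subset)
  then obtain c where "vertices K - {a, b} = {c}" by (rule card_1_singletonE)
  then have "vertices K = {a, b, c}" using assms by auto
  then show ?thesis using that two_simplex_vertices(2)[OF assms(1)] by metis
qed

lemma triangle_apex_unique:
  assumes "2 simplex (convex hull {a, b, c :: real^2})" "convex hull {a, b, c} = convex hull {a, b, d}"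
  shows "c = d"
proof -
  have "{a, b, c} = {a, b, d}"
    using vertices_triangle assms by metis
  then have "c \<in> {a, b, d}" by blast
  then show ?thesis
    using two_simplex_triangle(2)[OF assms(1)] by (auto simp: card_insert_if split: if_splits)
qed

lemma vertices_segment: "vertices (closed_segment a b) = {a, b}"
  by (auto simp: vertices_def extreme_point_of_segment)

lemma edge_of_triangle:
  assumes "2 simplex (convex hull {a, b, c :: real^2})"
  shows "closed_segment a b edge_of convex hull {a, b, c}"
proof -
  have "a \<noteq> b" using two_simplex_triangle(2)[OF assms] by (auto simp: card_insert_if split: if_splits)
  then have "aff_dim (closed_segment a b) = 1"
    by (simp add: segment_convex_hull aff_dim_convex_hull aff_dim_2)
  moreover have "closed_segment a b face_of convex hull {a, b, c}"
    unfolding face_of_convex_hull_affine_independent[OF two_simplex_triangle(1)[OF assms]]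
    by (rule exI[of _ "{a, b}"]) (auto simp: segment_convex_hull)
  ultimately show ?thesis by (simp add: edge_of_def)
qed

section \<open>Triangles sharing an edge\<close>

locale mesh =
  fixes \<Omega> :: "(real^2) set" and \<T> :: "(real^2) set set"
  assumes polygonal: "polygonal_domain \<Omega>" and triangulation: "triangulation_of \<Omega> \<T>"
begin

lemma finite_\<T>: "finite \<T>"
  and simplex_\<T>: "K \<in> \<T> \<Longrightarrow> 2 simplex K"
  and Int_face: "\<lbrakk>K \<in> \<T>; L \<in> \<T>\<rbrakk> \<Longrightarrow> K \<inter> L face_of K"
  and Union_\<T>: "\<Union>\<T> = closure \<Omega>"
  and frontier_edges: "frontier \<Omega> = \<Union>{e. e \<subseteq> frontier \<Omega> \<and> (\<exists>K\<in>\<T>. e edge_of K)}"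
  using triangulation unfolding triangulation_of_def triangulation_def by blast+

lemma open_\<Omega>: "open \<Omega>"
  using polygonal by (simp add: polygonal_domain_def)

lemma closure_cases: "x \<in> closure \<Omega> \<Longrightarrow> x \<in> \<Omega> \<or> x \<in> frontier \<Omega>"
  using open_\<Omega> by (auto simp: frontier_def interior_open)

lemma \<Omega>_frontier_disjoint: "x \<in> \<Omega> \<Longrightarrow> x \<notin> frontier \<Omega>"
  using open_\<Omega> by (auto simp: frontier_def interior_open)

text \<open>\<open>K \<inter> L\<close> is a face of \<open>K\<close>, and a face containing a
  relative interior point of a segment in \<open>K\<close> contains its endpoints.\<close>

lemma endpoints_in_triangle:
  assumes "K \<in> \<T>" "L \<in> \<T>" "a \<in> K" "b \<in> K" "x \<in> open_segment a b" "x \<in> L"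
  shows "a \<in> L" "b \<in> L"
proof -
  have "x \<in> K"
    using assms convex_simplex[OF simplex_\<T>[OF assms(1)]] by (meson convex_contains_open_segment subsetD)
  then show "a \<in> L" "b \<in> L"
    using face_ofD[OF Int_face[OF assms(1,2)] assms(5,3,4)] assms(6) by auto
qed

text \<open>The singleton \<open>{a}\<close> is a face of \<open>K \<inter> L\<close>, which in turn
  is a face of \<open>L\<close>; being a face is transitive.\<close>

lemma vertex_of_neighbour:
  assumes "K \<in> \<T>" "L \<in> \<T>" "a \<in> vertices K" "a \<in> L"
  shows "a \<in> vertices L"
proof -
  have "{a} face_of K" "a \<in> K"
    using assms(3) by (auto simp: vertices_def face_of_singleton extreme_point_of_def)
  then have "{a} face_of K \<inter> L"
    using assms(4) by (auto intro: face_of_subset)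
  then have "{a} face_of L"
    using Int_face[OF assms(2,1)] by (metis Int_commute face_of_trans)
  then show ?thesis by (simp add: vertices_def face_of_singleton)
qed

lemma interior_triangle_nonempty:
  assumes "K \<in> \<T>"
  shows "interior K \<noteq> {}"
proof -
  have "affine hull K = UNIV"
    using aff_dim_simplex[OF simplex_\<T>[OF assms]] aff_dim_eq_full[of K] by simp
  then have "rel_interior K = interior K" "K \<noteq> {}"
    by (auto simp: rel_interior_interior)
  then show ?thesis
    using rel_interior_eq_empty[OF convex_simplex[OF simplex_\<T>[OF assms]]] by simp
qed

text \<open>A face meeting the interior is the whole set. This is applied first to
  \<open>K \<inter> L\<close> inside \<open>K\<close> and then to \<open>K\<close> inside
  \<open>L\<close>.\<close>

lemma interior_triangle_disjoint:
  assumes "K \<in> \<T>" "L \<in> \<T>" "x \<in> interior K" "x \<in> L"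
  shows "K = L"
proof -
  have "x \<in> K" using assms(3) interior_subset by blast
  have KL: "K \<inter> L = K"
    using face_of_disjoint_interior[OF Int_face[OF assms(1,2)]] assms \<open>x \<in> K\<close> by blast
  then have "K face_of L" using Int_face[OF assms(2,1)] by (simp add: Int_commute)
  moreover have "x \<in> interior L" using KL assms(3) interior_mono[of K L] by blast
  ultimately show ?thesis
    using face_of_disjoint_interior[of K L] \<open>x \<in> K\<close> by blast
qed

text \<open>On the same side the triangles would overlap in an interior point, hence coincide and
  have the same apex.\<close>

lemma opposite_sides:
  assumes "convex hull {a, b, c} \<in> \<T>" "convex hull {a, b, d} \<in> \<T>" "c \<noteq> d"
  shows "det2 (b - a) (c - a) * det2 (b - a) (d - a) < 0"
proof (rule ccontr)
  assume "\<not> ?thesis"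
  moreover have "det2 (b - a) (c - a) \<noteq> 0" "det2 (b - a) (d - a) \<noteq> 0"
    using two_simplex_det2[of b c a] two_simplex_det2[of b d a] simplex_\<T>[OF assms(1)] simplex_\<T>[OF assms(2)]
    by (simp_all add: insert_commute)
  ultimately have "0 < det2 (b - a) (c - a) * det2 (b - a) (d - a)"
    by (simp add: not_less order.order_iff_strict)
  then obtain x where "x \<in> interior (convex hull {a, b, c})" "x \<in> convex hull {a, b, d}"
    using same_side_triangles_overlap[OF two_simplex_not_collinear[OF simplex_\<T>[OF assms(1)]]] by blast
  then have "convex hull {a, b, c} = convex hull {a, b, d}"
    using interior_triangle_disjoint assms by blast
  then show False
    using triangle_apex_unique[OF simplex_\<T>[OF assms(1)]] assms(3) by blast
qed

text \<open>Three distinct apexes would have to lie pairwise on opposite sides of one line.\<close>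

lemma triangles_at_edge:
  assumes c: "convex hull {a, b, c} \<in> \<T>" and d: "convex hull {a, b, d} \<in> \<T>" and "c \<noteq> d"
  shows "{K \<in> \<T>. a \<in> vertices K \<and> b \<in> vertices K} = {convex hull {a, b, c}, convex hull {a, b, d}}"
proof
  show "{convex hull {a, b, c}, convex hull {a, b, d}} \<subseteq> {K \<in> \<T>. a \<in> vertices K \<and> b \<in> vertices K}"
    using c d vertices_triangle simplex_\<T> by auto
  have "a \<noteq> b"
    using two_simplex_triangle(2)[OF simplex_\<T>[OF c]] by (auto simp: card_insert_if split: if_splits)
  show "{K \<in> \<T>. a \<in> vertices K \<and> b \<in> vertices K} \<subseteq> {convex hull {a, b, c}, convex hull {a, b, d}}"
  proof
    fix K assume "K \<in> {K \<in> \<T>. a \<in> vertices K \<and> b \<in> vertices K}"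
    then have K: "K \<in> \<T>" "a \<in> vertices K" "b \<in> vertices K" by auto
    obtain e where e: "K = convex hull {a, b, e}"
      using two_simplex_obtain_apex[OF simplex_\<T>[OF K(1)] K(2,3) \<open>a \<noteq> b\<close>] .
    have "e = c \<or> e = d"
    proof (rule ccontr)
      assume "\<not> (e = c \<or> e = d)"
      then show False
        using opposite_sides[OF c d] opposite_sides[of a b e c] opposite_sides[of a b e d] c d K(1) e \<open>c \<noteq> d\<close>
        by (auto simp: mult_less_0_iff)
    qed
    then show "K \<in> {convex hull {a, b, c}, convex hull {a, b, d}}" by (auto simp: e)
  qed
qed

text \<open>A boundary point \<open>x\<close> on the open segment would lie on a mesh edge
  \<open>e\<close> contained in the boundary. By the face property, first of the mesh and then of
  \<open>e\<close>, the endpoint \<open>a\<close> would belong to \<open>e\<close>, although it lies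
  in the open domain.\<close>

lemma edge_inside:
  assumes K: "K \<in> \<T>" "a \<in> K" "b \<in> K" and "a \<in> \<Omega>" "x \<in> open_segment a b"
  shows "x \<in> \<Omega>"
proof (rule ccontr)
  assume "x \<notin> \<Omega>"
  moreover have "x \<in> K"
    using assms convex_simplex[OF simplex_\<T>[OF K(1)]] by (meson convex_contains_open_segment subsetD)
  then have "x \<in> closure \<Omega>" using K(1) Union_\<T> by blast
  ultimately have "x \<in> frontier \<Omega>" using closure_cases by blast
  then obtain e L where e: "x \<in> e" "e \<subseteq> frontier \<Omega>" "L \<in> \<T>" "e face_of L"
    using frontier_edges unfolding edge_of_def by blast
  then have "x \<in> L" using face_of_imp_subset by blast
  then have "a \<in> e"
    using face_ofD[OF e(4) assms(5)] endpoints_in_triangle[OF K(1) e(3) K(2,3) assms(5)] e(1) by blast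
  then show False using e(2) \<Omega>_frontier_disjoint[OF \<open>a \<in> \<Omega>\<close>] by blast
qed

text \<open>Points slightly beyond the midpoint of the edge \<open>[a, b]\<close> are covered by a triangle which,
  by the face property, contains the whole edge.\<close>

lemma second_triangle:
  assumes c: "convex hull {a, b, c} \<in> \<T>" and "a \<in> \<Omega>"
  obtains d where "d \<noteq> c" "convex hull {a, b, d} \<in> \<T>"
proof -
  define K where "K = convex hull {a, b, c}"
  have K: "K \<in> \<T>" "a \<in> K" "b \<in> K" "c \<in> K" "vertices K = {a, b, c}"
    using c vertices_triangle[OF simplex_\<T>[OF c]] by (auto simp: K_def hull_inc)
  have ab: "a \<noteq> b"
    using two_simplex_triangle(2)[OF simplex_\<T>[OF c]] by (auto simp: card_insert_if split: if_splits)
  define m where "m = midpoint a b"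
  have m: "m \<in> open_segment a b" using ab by (simp add: m_def)
  then have "m \<in> \<Omega>" using edge_inside[OF K(1-3) \<open>a \<in> \<Omega>\<close>] by blast
  \<comment> \<open>A neighbourhood of the midpoint that meets only those triangles containing the
    midpoint.\<close>
  define U where "U = \<Omega> - \<Union>{L \<in> \<T>. m \<notin> L}"
  have "closed (\<Union>{L \<in> \<T>. m \<notin> L})"
    using finite_\<T> simplex_\<T> by (intro closed_Union) (auto intro: closed_simplex)
  then have "open U" using open_\<Omega> by (simp add: U_def open_Diff)
  moreover have "m \<in> U" using \<open>m \<in> \<Omega>\<close> by (auto simp: U_def)
  ultimately obtain r where r: "0 < r" "ball m r \<subseteq> U" by (meson openE)
  define \<delta> where "\<delta> = r / (2 * (1 + norm (c - m)))"
  have \<delta>: "0 < \<delta>" using r(1) by (simp add: \<delta>_def add_pos_nonneg)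
  define x where "x = m - \<delta> *\<^sub>R (c - m)"
  have "\<delta> * norm (c - m) < r"
  proof -
    have "\<delta> * norm (c - m) \<le> \<delta> * (1 + norm (c - m))" using \<delta> by (simp add: mult_left_mono)
    also have "\<dots> = r / 2"
      by (simp add: \<delta>_def add_nonneg_eq_0_iff field_simps)
    finally show ?thesis using r(1) by linarith
  qed
  then have "x \<in> ball m r" using \<delta> by (simp add: x_def dist_norm)
  then have "x \<in> U" using r by blast
  then have "x \<in> \<Omega>" by (simp add: U_def)
  then have "x \<in> \<Union>\<T>" using Union_\<T> closure_subset by blast
  then obtain L where L: "L \<in> \<T>" "x \<in> L" by blast
  then have "m \<in> L" using \<open>x \<in> U\<close> by (auto simp: U_def)
  then have "a \<in> L" "b \<in> L" using endpoints_in_triangle[OF K(1) L(1) K(2,3) m] by auto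
  then have "a \<in> vertices L" "b \<in> vertices L"
    using vertex_of_neighbour[OF K(1) L(1)] K(5) by auto
  then obtain d where d: "L = convex hull {a, b, d}"
    using two_simplex_obtain_apex[OF simplex_\<T>[OF L(1)] _ _ ab] by blast
  \<comment> \<open>All of \<open>K\<close> lies on the side of the edge where \<open>c\<close> is,
    while \<open>x\<close> is strictly on the other side; \<open>det2 (b - a)\<close> detects
    this.\<close>
  have "x \<notin> K"
  proof
    assume "x \<in> K"
    then obtain u v w where uvw: "0 \<le> w" "u + v + w = 1" "x = u *\<^sub>R a + v *\<^sub>R b + w *\<^sub>R c"
      unfolding K_def convex_hull_3 by blast
    have u: "u = 1 - v - w" using uvw(2) by simp
    have "det2 (b - a) (x - a) = w * det2 (b - a) (c - a)"
      unfolding uvw(3) u by (simp add: det2_def algebra_simps)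
    moreover have "det2 (b - a) (x - a) = - \<delta> * det2 (b - a) (c - a)"
      unfolding x_def m_def by (simp add: det2_def midpoint_def field_simps)
    moreover have "det2 (b - a) (c - a) \<noteq> 0"
      using two_simplex_det2[of b c a] simplex_\<T>[OF c] by (simp add: insert_commute)
    ultimately show False using \<delta> uvw(1) by (metis mult_cancel_right neg_less_0_iff_less not_less)
  qed
  then have "d \<noteq> c" using L(2) d by (auto simp: K_def)
  then show ?thesis using that d L(1) by blast
qed

section \<open>Integration over the mesh\<close>

lemma negligible_frontier: "negligible (frontier \<Omega>)"
proof -
  obtain \<S> where S: "finite \<S>" "\<forall>s\<in>\<S>. \<exists>a b. s = closed_segment a b" "frontier \<Omega> = \<Union>\<S>"
    using polygonal unfolding polygonal_domain_def by blast
  have "negligible (closed_segment a b)" for a b :: "real^2"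
    by (simp add: negligible_convex_interior interior_closed_segment_ge2)
  then show ?thesis using S by (auto intro!: negligible_Union)
qed

lemma negligible_frontier_triangle: "K \<in> \<T> \<Longrightarrow> negligible (frontier K)"
  using simplex_\<T> by (intro negligible_convex_frontier convex_simplex)

text \<open>Boundaries of the triangles and of the domain are null sets, so the integral splits into
  one term per triangle, whatever the values of \<open>f\<close> on the edges.\<close>

lemma has_integral_piecewise_constant:
  fixes f :: "real^2 \<Rightarrow> real"
  assumes "\<And>K x. \<lbrakk>K \<in> \<T>; x \<in> interior K\<rbrakk> \<Longrightarrow> f x = k K"
  shows "(f has_integral (\<Sum>K\<in>\<T>. k K * measure lebesgue K)) \<Omega>"
proof -
  have "(f has_integral (\<Sum>K\<in>\<T>. k K * measure lebesgue K)) (\<Union>\<T>)"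
  proof (rule has_integral_Union[OF finite_\<T>])
    fix K assume K: "K \<in> \<T>"
    then have cK: "compact K" using simplex_\<T> compact_simplex by blast
    then have "emeasure lborel K < \<infinity>" by (rule emeasure_compact_finite)
    then have "((\<lambda>x. 1) has_integral measure lborel K) K"
      using cK by (intro has_integral_measure_lborel) (auto simp: borel_compact)
    then have "((\<lambda>x. 1) has_integral measure lebesgue K) K"
      using cK by (simp add: measure_completion borel_compact)
    then have "((\<lambda>x. k K * 1) has_integral k K * measure lebesgue K) K"
      by (rule has_integral_mult_right)
    then show "(f has_integral k K * measure lebesgue K) K"
      by (rule has_integral_spike[OF negligible_frontier_triangle[OF K], rotated])
         (use assms[OF K] compact_imp_closed[OF cK] in \<open>auto simp: frontier_def\<close>)
  next
    show "pairwise (\<lambda>K L. negligible (K \<inter> L)) \<T>"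
    proof (intro pairwiseI)
      fix K L assume KL: "K \<in> \<T>" "L \<in> \<T>" "K \<noteq> L"
      then have "K \<inter> L \<subseteq> frontier K"
        using interior_triangle_disjoint closed_simplex[OF simplex_\<T>[OF KL(1)]]
        by (auto simp: frontier_def)
      then show "negligible (K \<inter> L)"
        using negligible_frontier_triangle[OF KL(1)] negligible_subset by blast
    qed
  qed
  then show ?thesis
    unfolding Union_\<T> by (simp add: has_integral_closure[OF negligible_frontier])
qed

end

section \<open>The stiffness matrix and the Delaunay property\<close>

lemma grad_affine:
  assumes "\<And>y. y \<in> K \<Longrightarrow> f y = g \<bullet> y + c" "x \<in> interior K"
  shows "grad f x = g"
proof -
  have "((\<lambda>y. g \<bullet> y + c) has_derivative (\<lambda>h. g \<bullet> h)) (at x)"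
    by (auto intro!: derivative_eq_intros)
  then have "(f has_derivative (\<lambda>h. g \<bullet> h)) (at x)"
    by (rule has_derivative_transform_within_open[OF _ open_interior assms(2)])
       (use assms(1) interior_subset in \<open>metis subsetD\<close>)
  then have "frechet_derivative f (at x) = (\<lambda>h. g \<bullet> h)"
    using frechet_derivative_at by metis
  then show ?thesis by (simp add: grad_def vec_eq_iff inner_axis)
qed

locale fem = mesh +
  fixes p :: "'n::finite \<Rightarrow> real^2" and \<phi> :: "'n \<Rightarrow> real^2 \<Rightarrow> real"
  assumes nodes: "bij_betw p UNIV (interior_nodes \<Omega> \<T>)" and basis: "nodal_basis \<Omega> \<T> p \<phi>"
begin

lemma p_eq_iff: "p i = p j \<longleftrightarrow> i = j"
  using nodes by (auto simp: bij_betw_def inj_def)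

lemma p_interior: "p i \<in> interior_nodes \<Omega> \<T>"
  using nodes by (auto simp: bij_betw_def)

lemma p_\<Omega>: "p i \<in> \<Omega>"
  using p_interior by (simp add: interior_nodes_def)

text \<open>A mesh vertex is either a node in the domain or a boundary point, where finite element
  functions vanish.\<close>

lemma \<phi>_vertex:
  assumes "K \<in> \<T>" "q \<in> vertices K"
  shows "\<phi> i q = (if q = p i then 1 else 0)"
proof (cases "q \<in> \<Omega>")
  case True
  then have "q \<in> interior_nodes \<Omega> \<T>" using assms by (auto simp: interior_nodes_def)
  then obtain j where "q = p j" using nodes by (auto simp: bij_betw_def)
  then show ?thesis using basis p_eq_iff by (auto simp: nodal_basis_def)
next
  case False
  have "q \<in> closure \<Omega>"
    using assms Union_\<T> by (auto simp: vertices_def extreme_point_of_def)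
  then have "q \<in> frontier \<Omega>" using False closure_cases by blast
  then show ?thesis using basis False p_\<Omega> by (auto simp: nodal_basis_def fe_space_def)
qed

text \<open>The constant gradient of \<open>\<phi> i\<close> on a triangle. On mesh triangles the
  choice is unique because their interior is nonempty.\<close>

definition slope :: "'n \<Rightarrow> (real^2) set \<Rightarrow> real^2" where
  "slope i K = (SOME g. \<exists>c. \<forall>x\<in>K. \<phi> i x = g \<bullet> x + c)"

lemma slope:
  assumes "K \<in> \<T>"
  obtains c where "\<And>x. x \<in> K \<Longrightarrow> \<phi> i x = slope i K \<bullet> x + c"
proof -
  have "\<exists>g c. \<forall>x\<in>K. \<phi> i x = g \<bullet> x + c"
    using basis assms by (auto simp: nodal_basis_def fe_space_def)
  from someI_ex[OF this] show ?thesis using that unfolding slope_def by blast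
qed

lemma slope_inner_diff:
  assumes "K \<in> \<T>" "q \<in> vertices K" "r \<in> vertices K"
  shows "slope i K \<bullet> (q - r) = (if q = p i then 1 else 0) - (if r = p i then 1 else 0)"
proof -
  obtain c where c: "\<And>x. x \<in> K \<Longrightarrow> \<phi> i x = slope i K \<bullet> x + c" using slope[OF assms(1), of i] by blast
  have "q \<in> K" "r \<in> K" using assms by (auto simp: vertices_def extreme_point_of_def)
  then have "slope i K \<bullet> (q - r) = \<phi> i q - \<phi> i r" by (simp add: c inner_diff_right)
  then show ?thesis by (simp only: \<phi>_vertex[OF assms(1,2)] \<phi>_vertex[OF assms(1,3)])
qed

text \<open>The nodal function vanishes at all three vertices, so its gradient is orthogonal to two
  independent edge vectors.\<close>

lemma slope_eq_0:
  assumes K: "K \<in> \<T>" and "p i \<notin> vertices K"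
  shows "slope i K = 0"
proof -
  obtain C where "card C = 3" "K = convex hull C"
    using two_simplex_vertices[OF simplex_\<T>[OF K]] by metis
  then obtain a b c where abc: "K = convex hull {a, b, c}" by (metis card_3_iff)
  have s: "2 simplex (convex hull {a, b, c})" using simplex_\<T>[OF K] abc by simp
  have V: "vertices K = {a, b, c}" using vertices_triangle[OF s] abc by simp
  then have "slope i K \<bullet> (a - c) = 0" "slope i K \<bullet> (b - c) = 0"
    using assms(2) slope_inner_diff[OF K, of a c i] slope_inner_diff[OF K, of b c i] by auto
  then show ?thesis by (rule real2_eq_0_if_orthogonal[OF two_simplex_det2[OF s]])
qed

lemma stiffness_entry:
  "stiffness_matrix \<Omega> \<phi> $ i $ j = (\<Sum>K\<in>\<T>. (slope j K \<bullet> slope i K) * measure lebesgue K)"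
proof -
  have "((\<lambda>x. grad (\<phi> j) x \<bullet> grad (\<phi> i) x) has_integral
      (\<Sum>K\<in>\<T>. (slope j K \<bullet> slope i K) * measure lebesgue K)) \<Omega>"
  proof (rule has_integral_piecewise_constant)
    fix K x assume K: "K \<in> \<T>" "x \<in> interior K"
    have "grad (\<phi> i) x = slope i K" for i
      by (rule slope[OF K(1), of i]) (rule grad_affine[OF _ K(2)])
    then show "grad (\<phi> j) x \<bullet> grad (\<phi> i) x = slope j K \<bullet> slope i K" by simp
  qed
  then show ?thesis by (simp add: stiffness_matrix_def integral_unique)
qed

text \<open>The quadratic form is the Dirichlet energy: on each triangle, the area times the squared
  norm of the gradient of the combination with coefficients \<open>x\<close>.\<close>

lemma stiffness_psd: "0 \<le> x \<bullet> (stiffness_matrix \<Omega> \<phi> *v x)"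
proof -
  have "x \<bullet> (stiffness_matrix \<Omega> \<phi> *v x) =
      (\<Sum>i\<in>UNIV. \<Sum>j\<in>UNIV. \<Sum>K\<in>\<T>. measure lebesgue K * ((x $ j *\<^sub>R slope j K) \<bullet> (x $ i *\<^sub>R slope i K)))"
    by (simp add: inner_vec_def[of x] matrix_vector_mult_def stiffness_entry sum_distrib_left sum_distrib_right mult_ac)
  also have "\<dots> = (\<Sum>K\<in>\<T>. \<Sum>i\<in>UNIV. \<Sum>j\<in>UNIV. measure lebesgue K * ((x $ j *\<^sub>R slope j K) \<bullet> (x $ i *\<^sub>R slope i K)))"
  proof -
    have "(\<Sum>i\<in>UNIV. \<Sum>j\<in>UNIV. \<Sum>K\<in>\<T>. f i j K) = (\<Sum>K\<in>\<T>. \<Sum>i\<in>UNIV. \<Sum>j\<in>UNIV. f i j K)"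
      for f :: "'n \<Rightarrow> 'n \<Rightarrow> (real^2) set \<Rightarrow> real"
    proof -
      have "(\<Sum>i\<in>UNIV. \<Sum>j\<in>UNIV. \<Sum>K\<in>\<T>. f i j K) = (\<Sum>i\<in>UNIV. \<Sum>K\<in>\<T>. \<Sum>j\<in>UNIV. f i j K)"
        by (intro sum.cong refl sum.swap)
      also have "\<dots> = (\<Sum>K\<in>\<T>. \<Sum>i\<in>UNIV. \<Sum>j\<in>UNIV. f i j K)" by (rule sum.swap)
      finally show ?thesis .
    qed
    then show ?thesis .
  qed
  also have "\<dots> = (\<Sum>K\<in>\<T>. measure lebesgue K * ((\<Sum>j\<in>UNIV. x $ j *\<^sub>R slope j K) \<bullet> (\<Sum>i\<in>UNIV. x $ i *\<^sub>R slope i K)))"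
    by (simp only: inner_sum_left inner_sum_right sum_distrib_left)
  also have "\<dots> \<ge> 0"
    by (intro sum_nonneg mult_nonneg_nonneg inner_ge_zero) simp
  finally show ?thesis .
qed

definition node_mass :: "'n \<Rightarrow> real" where
  "node_mass i = (\<Sum>K\<in>\<T>. 1/3 * measure lebesgue K * (\<Sum>q\<in>vertices K. if q = p i then 1 else 0))"

text \<open>The quadrature samples vertices only, and at each of them at most one nodal function is
  nonzero.\<close>

lemma lumped_mass_diagonal:
  "lumped_mass_matrix \<T> \<phi> = (\<chi> i j. if i = j then node_mass i else 0)"
proof -
  have "lumped_inner \<T> (\<phi> j) (\<phi> i) = (if i = j then node_mass i else 0)" for i j
  proof -
    have "lumped_inner \<T> (\<phi> j) (\<phi> i) = (\<Sum>K\<in>\<T>. 1/3 * measure lebesgue K *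
        (\<Sum>q\<in>vertices K. if q = p i \<and> i = j then 1 else 0))"
      unfolding lumped_inner_def
      by (intro sum.cong refl arg_cong2[where f = times]) (auto simp: \<phi>_vertex p_eq_iff)
    then show ?thesis by (auto simp: node_mass_def)
  qed
  then show ?thesis by (simp add: lumped_mass_matrix_def)
qed

lemma node_mass_pos: "0 < node_mass i"
proof -
  obtain K where K: "K \<in> \<T>" "p i \<in> vertices K"
    using p_interior[of i] by (auto simp: interior_nodes_def)
  have fin: "finite (vertices K)"
    using two_simplex_vertices(1)[OF simplex_\<T>[OF K(1)]] card.infinite by force
  have "K \<in> lmeasurable" using simplex_\<T>[OF K(1)] compact_simplex by (blast intro: lmeasurable_compact)
  moreover have "\<not> negligible K"
    using interior_triangle_nonempty[OF K(1)] open_not_negligible negligible_subset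
    by (metis interior_subset open_interior)
  ultimately have "0 < measure lebesgue K"
    by (simp add: negligible_iff_measure0 less_le)
  then show ?thesis
    unfolding node_mass_def
    by (intro sum_pos2[OF finite_\<T> K(1)] mult_pos_pos mult_nonneg_nonneg sum_nonneg)
       (use K fin in \<open>auto simp: sum.delta\<close>)
qed

sublocale lumped "lumped_mass_matrix \<T> \<phi>" "stiffness_matrix \<Omega> \<phi>" "lm_matrix \<Omega> \<T> \<phi>" node_mass
  by unfold_locales (auto simp: lumped_mass_diagonal node_mass_pos stiffness_psd lm_matrix_def)

text \<open>The cotangent formula: the quotient on the right is minus the cotangent of the angle at
  \<open>c\<close>. It comes from the dual basis identity with edge vectors \<open>p i - c\<close>
  and \<open>p j - c\<close>, the area cancelling one power of the determinant.\<close>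

lemma local_stiffness:
  assumes K: "convex hull {p i, p j, c} \<in> \<T>"
  shows "(slope j (convex hull {p i, p j, c}) \<bullet> slope i (convex hull {p i, p j, c})) *
      measure lebesgue (convex hull {p i, p j, c}) =
    - ((p i - c) \<bullet> (p j - c)) / \<bar>det2 (p i - c) (p j - c)\<bar> / 2"
proof -
  define L where "L = convex hull {p i, p j, c}"
  define D where "D = det2 (p i - c) (p j - c)"
  have s: "2 simplex (convex hull {p i, p j, c})" using simplex_\<T>[OF K] .
  have V: "vertices L = {p i, p j, c}" using vertices_triangle[OF s] by (simp add: L_def)
  have L: "L \<in> \<T>" using K by (simp add: L_def)
  have ne: "p i \<noteq> p j" "p i \<noteq> c" "p j \<noteq> c"
    using two_simplex_triangle(2)[OF s] by (auto simp: card_insert_if split: if_splits)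
  have D: "D \<noteq> 0" using two_simplex_det2[OF s] by (simp add: D_def)
  have "(slope j L \<bullet> slope i L) * D\<^sup>2 = - ((p i - c) \<bullet> (p j - c))"
    unfolding D_def
    by (rule inner_dual_basis_real2; subst slope_inner_diff[OF L]) (use V ne in auto)
  moreover have "measure lebesgue L = \<bar>D\<bar> / 2"
    by (simp add: L_def D_def content_triangle_det2)
  moreover have "X * m = Y / A / 2" if "X * A\<^sup>2 = Y" "m = A / 2" "A \<noteq> 0" for X Y A m :: real
    using that by (simp add: field_simps power2_eq_square)
  ultimately have "(slope j L \<bullet> slope i L) * measure lebesgue L = - ((p i - c) \<bullet> (p j - c)) / \<bar>D\<bar> / 2"
    using D by (metis abs_eq_0_iff power2_abs)
  then show ?thesis by (simp add: L_def D_def)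
qed

lemma stiffness_edge_nonpos_iff:
  assumes c: "convex hull {p i, p j, c} \<in> \<T>" and d: "convex hull {p i, p j, d} \<in> \<T>" and "c \<noteq> d"
  shows "stiffness_matrix \<Omega> \<phi> $ i $ j \<le> 0 \<longleftrightarrow> angle_at c (p i) (p j) + angle_at d (p i) (p j) \<le> pi"
proof -
  have ne: "convex hull {p i, p j, c} \<noteq> convex hull {p i, p j, d}"
    using triangle_apex_unique[OF simplex_\<T>[OF c]] \<open>c \<noteq> d\<close> by blast
  have "stiffness_matrix \<Omega> \<phi> $ i $ j =
      (\<Sum>K\<in>{K \<in> \<T>. p i \<in> vertices K \<and> p j \<in> vertices K}. (slope j K \<bullet> slope i K) * measure lebesgue K)"
    unfolding stiffness_entry
    \<comment> \<open>A triangle missing one of the two nodes contributes nothing, since the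
      corresponding slope vanishes there.\<close>
    by (rule sum.mono_neutral_right[OF finite_\<T>])
       (auto, (metis slope_eq_0 inner_zero_left inner_zero_right)+)
  also have "\<dots> = - ((p i - c) \<bullet> (p j - c)) / \<bar>det2 (p i - c) (p j - c)\<bar> / 2
      + - ((p i - d) \<bullet> (p j - d)) / \<bar>det2 (p i - d) (p j - d)\<bar> / 2"
    unfolding triangles_at_edge[OF c d \<open>c \<noteq> d\<close>] using ne by (simp add: local_stiffness[OF c] local_stiffness[OF d])
  finally show ?thesis
    unfolding angle_sum_le_pi_iff[OF two_simplex_det2[OF simplex_\<T>[OF c]] two_simplex_det2[OF simplex_\<T>[OF d]]]
    by (auto simp: field_simps)
qed

text \<open>Nodes without a common triangle give a zero entry. Two nodes sharing a triangle span an
  interior edge, which has a second triangle because its endpoints lie in the domain; the entry then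
  has the sign prescribed by the two opposite angles.\<close>

lemma delaunay_iff_stiffness_nonpos:
  "delaunay \<Omega> \<T> \<longleftrightarrow> (\<forall>i j. i \<noteq> j \<longrightarrow> stiffness_matrix \<Omega> \<phi> $ i $ j \<le> 0)"
proof (intro iffI allI impI)
  fix i j :: 'n assume del: "delaunay \<Omega> \<T>" and "i \<noteq> j"
  show "stiffness_matrix \<Omega> \<phi> $ i $ j \<le> 0"
  proof (cases "\<exists>K\<in>\<T>. p i \<in> vertices K \<and> p j \<in> vertices K")
    case False
    then have "(slope j K \<bullet> slope i K) * measure lebesgue K = 0" if "K \<in> \<T>" for K
      using slope_eq_0[OF that] that by fastforce
    then show ?thesis unfolding stiffness_entry by (intro sum_nonpos eq_refl)
  next
    case True
    then obtain K where K: "K \<in> \<T>" "p i \<in> vertices K" "p j \<in> vertices K" by blast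
    moreover have "p i \<noteq> p j" using \<open>i \<noteq> j\<close> p_eq_iff by blast
    ultimately obtain c where c: "K = convex hull {p i, p j, c}"
      using two_simplex_obtain_apex[OF simplex_\<T>] by metis
    then have cT: "convex hull {p i, p j, c} \<in> \<T>" using K by simp
    obtain d where d: "d \<noteq> c" "convex hull {p i, p j, d} \<in> \<T>"
      using second_triangle[OF cT p_\<Omega>] .
    have "interior_edge \<Omega> \<T> (closed_segment (p i) (p j))"
      unfolding interior_edge_def vertices_segment
      using edge_of_triangle[OF simplex_\<T>[OF cT]] cT p_interior by auto
    then have "delaunay_edge \<T> (closed_segment (p i) (p j))"
      using del by (simp add: delaunay_def)
    then have "angle_at c (p i) (p j) + angle_at d (p i) (p j) \<le> pi"
      by (rule delaunay_edge_def[THEN iffD1, rule_format]) (use cT d in simp)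
    then show ?thesis using stiffness_edge_nonpos_iff[OF cT d(2)] d(1) by simp
  qed
next
  assume off: "\<forall>i j. i \<noteq> j \<longrightarrow> stiffness_matrix \<Omega> \<phi> $ i $ j \<le> 0"
  show "delaunay \<Omega> \<T>"
    unfolding delaunay_def delaunay_edge_def
  proof (intro allI impI, elim conjE)
    fix e a b c d assume e: "interior_edge \<Omega> \<T> e" "e = closed_segment a b"
      and cd: "c \<noteq> d" "convex hull {a, b, c} \<in> \<T>" "convex hull {a, b, d} \<in> \<T>"
    have "a \<in> interior_nodes \<Omega> \<T>" "b \<in> interior_nodes \<Omega> \<T>"
      using e by (auto simp: interior_edge_def vertices_segment)
    then obtain i j where ij: "a = p i" "b = p j"
      using bij_betw_imp_surj_on[OF nodes] by (metis imageE)
    have "a \<noteq> b"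
      using two_simplex_triangle(2)[OF simplex_\<T>[OF cd(2)]] by (auto simp: card_insert_if split: if_splits)
    then have "i \<noteq> j" using ij by blast
    then have "stiffness_matrix \<Omega> \<phi> $ i $ j \<le> 0" using off by blast
    then show "angle_at c a b + angle_at d a b \<le> pi"
      using stiffness_edge_nonpos_iff cd ij by metis
  qed
qed

end

section \<open>Nonnegativity of the solution matrices and the Delaunay property\<close>

theorem theorem4p4:
  fixes \<Omega> :: "(real^2) set" and \<F> :: "(real^2) set set set" and \<T> :: "(real^2) set set"
    and p :: "'n::finite \<Rightarrow> real^2" and \<phi> :: "'n \<Rightarrow> real^2 \<Rightarrow> real"
    and P :: "real \<Rightarrow> real" and \<omega> :: "real \<Rightarrow> nat \<Rightarrow> real"
  assumes domain: "polygonal_domain \<Omega>"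
    and family: "shape_regular_quasi_uniform \<Omega> \<F>" "\<T> \<in> \<F>"
    and nodes: "bij_betw p UNIV (interior_nodes \<Omega> \<T>)"
    and basis: "nodal_basis \<Omega> \<T> p \<phi>"
    and charfun: "characteristic_function P"
    and weights: "\<And>\<tau>. \<tau> > 0 \<Longrightarrow> scheme_weights P \<tau> (\<omega> \<tau>)"
  shows "(delaunay \<Omega> \<T> \<longrightarrow>
      (\<forall>\<tau>>0. \<forall>n\<ge>1. \<forall>i j. 0 \<le> solution_matrix (\<omega> \<tau>) (lm_matrix \<Omega> \<T> \<phi>) n $ i $ j)) \<and>
    ((\<forall>\<tau>>0. \<forall>i j. 0 \<le> solution_matrix (\<omega> \<tau>) (lm_matrix \<Omega> \<T> \<phi>) 1 $ i $ j) \<longrightarrow>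
      delaunay \<Omega> \<T>)"
proof -
  interpret fem \<Omega> \<T> p \<phi>
    using domain family nodes basis by unfold_locales (auto simp: shape_regular_quasi_uniform_def)
  \<comment> \<open>The generating function is evaluated at \<xi> = 0.\<close>
  have \<omega>0: "\<omega> \<tau> 0 = P (1 / \<tau>)" if "0 < \<tau>" for \<tau>
    using weights[OF that] by (auto simp: scheme_weights_def dest!: spec[of _ 0])
  show ?thesis
  proof (intro conjI impI allI)
    fix \<tau> :: real and n :: nat and i j assume "delaunay \<Omega> \<T>" "0 < \<tau>"
    \<comment> \<open>Column \<open>j\<close> of the solution matrix is the discrete solution
      started from the nonnegative vector \<open>axis j 1\<close>.\<close>
    then show "0 \<le> solution_matrix (\<omega> \<tau>) (lm_matrix \<Omega> \<T> \<phi>) n $ i $ j"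
      using characteristic_function_weights[OF charfun _ weights] characteristic_function_pos[OF charfun, of "1 / \<tau>"]
      by (auto simp: solution_matrix_def matrix_def delaunay_iff_stiffness_nonpos \<omega>0 axis_def
          intro!: discrete_solution_nonneg)
  next
    assume E: "\<forall>\<tau>>0. \<forall>i j. 0 \<le> solution_matrix (\<omega> \<tau>) (lm_matrix \<Omega> \<T> \<phi>) 1 $ i $ j"
    show "delaunay \<Omega> \<T>"
      unfolding delaunay_iff_stiffness_nonpos
    proof (intro allI impI, rule off_diagonal_nonpos)
      fix i j :: 'n and L :: real
      obtain c \<beta> where c: "0 < c" "0 < \<beta>" "\<And>z. 1 \<le> z \<Longrightarrow> c * z powr \<beta> \<le> P z"
        using characteristic_function_lower_bound[OF charfun] by metis
      \<comment> \<open>Solves \<open>c * z powr \<beta> \<ge> \<bar>L\<bar> + 1\<close> subject to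
        \<open>z \<ge> 1\<close>, the range of the growth bound; the time step used is
        \<open>1 / z\<close>.\<close>
      define z where "z = max 1 ((\<bar>L\<bar> + 1) / c) powr (1 / \<beta>)"
      have z: "1 \<le> z" unfolding z_def using c(2) by (simp add: ge_one_powr_ge_zero)
      have "\<bar>L\<bar> + 1 \<le> c * max 1 ((\<bar>L\<bar> + 1) / c)"
        using c(1) by (simp add: max_def field_simps)
      also have "\<dots> = c * z powr \<beta>" using c(2) by (simp add: z_def powr_powr)
      also have "\<dots> \<le> P z" using c(3)[OF z] .
      finally have "L < P z" by simp
      moreover have "0 \<le> (matrix_inv (shifted (P z)) *v (P z *\<^sub>R axis j 1)) $ i"
      proof -
        have "\<omega> (1 / z) 0 = P z" using \<omega>0[of "1 / z"] z by simp
        \<comment> \<open>For the first step the history sum is empty, so column \<open>j\<close> is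
          the inverse of \<open>shifted (P z)\<close> applied to
          \<open>P z *\<^sub>R axis j 1\<close>.\<close>
        moreover have "0 \<le> solution_matrix (\<omega> (1 / z)) (lm_matrix \<Omega> \<T> \<phi>) 1 $ i $ j"
          using E z by simp
        ultimately show ?thesis
          by (simp add: solution_matrix_def matrix_def discrete_solution.simps[of _ _ _ "Suc 0"] shifted_def)
      qed
      ultimately show "\<exists>w>L. 0 \<le> (matrix_inv (shifted w) *v (w *\<^sub>R axis j 1)) $ i" by blast
    qed
  qed
qed

end
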